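(* Let $\mathbb{X}=\mathbb{R}^{n_x}$, $\mathbb{U}=\mathbb{R}^{n_u}$, $T>0$ an integer, $\eta>-1$, $\eta\ne0$. Consider the linear Gaussian system $p(x_{t+1}\mid x_t,u_t)=\mathcal{N}(A_tx_t+B_tu_t,\Sigma_t)$, $t\in\{0,\dots,T-1\}$, with quadratic costs $c_t(x,u)=(x^\top Q_tx+u^\top R_tu)/2$ and $c_T(x)=x^\top Q_Tx/2$, where $\Sigma_t$, $Q_t$, $R_t$ are positive definite for all $t$. Assume there exists a solution $\{\Pi_t\}_{t=0}^T$ of the Riccati difference equation $$\Pi_t=Q_t+A_t^\top\Pi_{t+1}\big(I-\eta\Sigma_t\Pi_{t+1}+B_tR_t^{-1}B_t^\top\Pi_{t+1}\big)^{-1}A_t,\ \ t\in\{0,\dots,T-1\},\qquad \Pi_T=Q_T,$$ such that $\Sigma_t^{-1}-\eta\Pi_{t+1}$ is positive definite for every $t\in\{0,\dots,T-1\}$. Then the unique optimal policy of the problem $$\underset{\{\pi_t\}_{t=0}^{T-1}}{\mathrm{minimize}}\ \frac{1}{\eta}\log\mathbb{E}\Big[\exp\Big(\eta c_T(x_T)+\eta\sum_{t=0}^{T-1}\big(c_t(x_t,u_t)+\log\pi_t(u_t\mid x_t)\big)\Big)\Big]$$ (with $u_t\sim\pi_t(\cdot\mid x_t)$, each $\pi_t(\cdot\mid x)$ a probability density on $\mathbb{U}$) is $$\pi_t^*(u\mid x)=\mathcal{N}\Big(u\,\Big|\,-\big(R_t+B_t^\top\Pi_{t+1}(I-\eta\Sigma_t\Pi_{t+1})^{-1}B_t\big)^{-1}B_t^\top\Pi_{t+1}(I-\eta\Sigma_t\Pi_{t+1})^{-1}A_tx,\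 \big(R_t+B_t^\top\Pi_{t+1}(I-\eta\Sigma_t\Pi_{t+1})^{-1}B_t\big)^{-1}\Big).$$
   Context: $\mathcal{N}(\cdot\mid\mu,\Sigma)$ denotes the Gaussian density with mean $\mu$ and covariance $\Sigma$; $I$ is the identity matrix of appropriate dimension. The initial state $x_0$ has an arbitrary given distribution.
   Formalization: Uniqueness is claimed only when the optimal value is finite (for η>0 and heavy-tailed x_0 every policy has value +∞, so uniqueness fails), and it means equality of densities for almost every u and almost every x. *)

theory Defs
  imports "HOL-Probability.Probability"
begin

definition pos_def :: "real^'n^'n \<Rightarrow> bool" where
  "pos_def M \<longleftrightarrow> transpose M = M \<and> (\<forall>x. x \<noteq> 0 \<longrightarrow> x \<bullet> (M *v x) > 0)"

definition gauss_density :: "real^'k \<Rightarrow> real^'k^'k \<Rightarrow> real^'k \<Rightarrow> real" where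
  "gauss_density mu S y =
     exp (- ((y - mu) \<bullet> (matrix_inv S *v (y - mu))) / 2)
     / sqrt ((2 * pi) ^ CARD('k) * det S)"

definition admissible_policy ::
  "nat \<Rightarrow> (nat \<Rightarrow> real^'n \<Rightarrow> real^'m \<Rightarrow> real) \<Rightarrow> bool" where
  "admissible_policy T pol \<longleftrightarrow>
     (\<forall>t<T. case_prod (pol t) \<in> borel_measurable borel
        \<and> (\<forall>x u. 0 \<le> pol t x u)
        \<and> (\<forall>x. (\<integral>\<^sup>+ u. ennreal (pol t x u) \<partial>lborel) = 1))"

definition stage_cost :: "real^'n^'n \<Rightarrow> real^'m^'m \<Rightarrow> real^'n \<Rightarrow> real^'m \<Rightarrow> real" where
  "stage_cost Qt Rt x u = (x \<bullet> (Qt *v x) + u \<bullet> (Rt *v u)) / 2"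

definition term_cost :: "real^'n^'n \<Rightarrow> real^'n \<Rightarrow> real" where
  "term_cost QT x = x \<bullet> (QT *v x) / 2"

text \<open>Conditional expectation of exp(eta * (remaining cost incl. entropy terms)),
  given the state at time T - k, with k steps remaining (backward nested integrals,
  i.e. the trajectory expectation written via Tonelli).\<close>
fun exp_cost_to_go ::
  "nat \<Rightarrow> real \<Rightarrow> (nat \<Rightarrow> real^'n^'n) \<Rightarrow> (nat \<Rightarrow> real^'m^'n) \<Rightarrow> (nat \<Rightarrow> real^'n^'n)
   \<Rightarrow> (nat \<Rightarrow> real^'n^'n) \<Rightarrow> (nat \<Rightarrow> real^'m^'m)
   \<Rightarrow> (nat \<Rightarrow> real^'n \<Rightarrow> real^'m \<Rightarrow> real) \<Rightarrow> nat \<Rightarrow> real^'n \<Rightarrow> ennreal" where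
  "exp_cost_to_go T \<eta> A B \<Sigma> Q R pol 0 x = ennreal (exp (\<eta> * term_cost (Q T) x))"
| "exp_cost_to_go T \<eta> A B \<Sigma> Q R pol (Suc k) x =
     (let t = T - Suc k in
      \<integral>\<^sup>+ u. ennreal (pol t x u)
              * ennreal (exp (\<eta> * (stage_cost (Q t) (R t) x u + ln (pol t x u))))
              * (\<integral>\<^sup>+ y. ennreal (gauss_density (A t *v x + B t *v u) (\<Sigma> t) y)
                        * exp_cost_to_go T \<eta> A B \<Sigma> Q R pol k y \<partial>lborel) \<partial>lborel)"

definition eta_log :: "real \<Rightarrow> ennreal \<Rightarrow> ereal" where
  "eta_log \<eta> E =
     (if E = \<infinity> then (if \<eta> > 0 then \<infinity> else - \<infinity>)
      else if E = 0 then (if \<eta> > 0 then - \<infinity> else \<infinity>)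
      else ereal (ln (enn2real E) / \<eta>))"

definition rs_objective ::
  "nat \<Rightarrow> real \<Rightarrow> (nat \<Rightarrow> real^'n^'n) \<Rightarrow> (nat \<Rightarrow> real^'m^'n) \<Rightarrow> (nat \<Rightarrow> real^'n^'n)
   \<Rightarrow> (nat \<Rightarrow> real^'n^'n) \<Rightarrow> (nat \<Rightarrow> real^'m^'m) \<Rightarrow> (real^'n) measure
   \<Rightarrow> (nat \<Rightarrow> real^'n \<Rightarrow> real^'m \<Rightarrow> real) \<Rightarrow> ereal" where
  "rs_objective T \<eta> A B \<Sigma> Q R \<mu>0 pol =
     eta_log \<eta> (\<integral>\<^sup>+ x. exp_cost_to_go T \<eta> A B \<Sigma> Q R pol T x \<partial>\<mu>0)"

definition Mmat :: "real \<Rightarrow> (nat \<Rightarrow> real^'n^'n) \<Rightarrow> (nat \<Rightarrow> real^'n^'n) \<Rightarrow> nat \<Rightarrow> real^'n^'n" where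
  "Mmat \<eta> \<Sigma> P t = matrix_inv (mat 1 - \<eta> *\<^sub>R (\<Sigma> t ** P (Suc t)))"

definition opt_policy ::
  "real \<Rightarrow> (nat \<Rightarrow> real^'n^'n) \<Rightarrow> (nat \<Rightarrow> real^'m^'n) \<Rightarrow> (nat \<Rightarrow> real^'n^'n)
   \<Rightarrow> (nat \<Rightarrow> real^'m^'m) \<Rightarrow> (nat \<Rightarrow> real^'n^'n) \<Rightarrow> nat \<Rightarrow> real^'n \<Rightarrow> real^'m \<Rightarrow> real" where
  "opt_policy \<eta> A B \<Sigma> R P t x u =
     (let S = matrix_inv (R t + transpose (B t) ** P (Suc t) ** Mmat \<eta> \<Sigma> P t ** B t)
      in gauss_density (- (S ** transpose (B t) ** P (Suc t) ** Mmat \<eta> \<Sigma> P t ** A t *v x)) S u)"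

end

theory Submission
  imports Defs
begin

text \<open>
  Tilting a Gaussian by \<open>exp (\<eta> y\<^sup>T \<Pi> y / 2)\<close> again gives an exponential of a quadratic form in the mean, and
  completing the square in the control shows that, if all later controls are optimal, the factor
  multiplying \<open>\<pi>(u | x)\<^bsup>1+\<eta>\<^esup>\<close> is \<open>V(x) \<pi>\<^sup>*(u | x)\<^bsup>-\<eta>\<^esup>\<close>, where \<open>V\<close> is a constant times \<open>exp (\<eta> x\<^sup>T \<Pi>\<^sub>t x / 2)\<close>. The
  exponential cost to go is therefore \<open>V(x)\<close> times the integral of \<open>(\<pi> / \<pi>\<^sup>*)\<^bsup>1+\<eta>\<^esup> \<pi>\<^sup>*\<close>. The tangent to \<open>s \<mapsto> s\<^bsup>1+\<eta>\<^esup>\<close> at 1 bounds this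
  integral by 1 from below (\<open>\<eta> > 0\<close>) or above (\<open>\<eta> < 0\<close>), with equality only for \<open>\<pi> = \<pi>\<^sup>*\<close> almost
  everywhere. Backward induction gives optimality; equality at the initial time propagates forward,
  because Gaussian transition densities are positive everywhere.
\<close>

section \<open>Linear change of variables\<close>

text \<open>The power \<open>1 + \<eta>\<close> is positive because eta > -1; it is convex for eta >
  0 and concave for eta < 0. Dividing by eta reverses the order in exactly the second case, so a
  single relation, \<open>eta_le\<close>, covers both signs. All expectations stay in
  \<open>ennreal\<close>: a competing policy may have infinite cost, and finiteness enters only when
  equality is analysed. Positive definiteness of Sigma^{-1} - eta Pi makes the tilted Gaussian
  integral finite. Positive definiteness of Pi itself has to be derived, backwards from Q_T: the
  completed square displays x^T Pi_t x as the minimum over u of a sum of nonnegative terms. The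
  policy contains the inverse of I - eta Sigma Pi, the Riccati equation the inverse of that matrix
  plus B R^{-1} B^T Pi. The link between the two is a Woodbury identity, proved on vectors. The
  integration constants of each stage depend on neither state nor control, so they never affect the
  minimiser and are collected in one scalar per stage.\<close>

lemma nn_integral_lborel_translate:
  fixes f :: "'a::euclidean_space \<Rightarrow> ennreal"
  assumes [measurable]: "f \<in> borel_measurable borel"
  shows "(\<integral>\<^sup>+ x. f (c + x) \<partial>lborel) = (\<integral>\<^sup>+ x. f x \<partial>lborel)"
proof -
  have "(\<integral>\<^sup>+ x. f x \<partial>lborel) = (\<integral>\<^sup>+ x. f x \<partial>distr lborel borel ((+) c))"
    by (simp add: lborel_distr_plus)
  also have "\<dots> = (\<integral>\<^sup>+ x. f (c + x) \<partial>lborel)"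
    by (subst nn_integral_distr) auto
  finally show ?thesis by simp
qed

text \<open>Averaging over a unit interval of translations along \<open>e\<close> reduces the shear to Tonelli's theorem and
  translation invariance.\<close>

lemma nn_integral_lborel_shear:
  fixes f :: "'a::euclidean_space \<Rightarrow> ennreal" and g :: "'a \<Rightarrow> real" and e :: 'a
  assumes [measurable]: "f \<in> borel_measurable borel" "g \<in> borel_measurable borel"
    and inv: "\<And>x s. g (x + s *\<^sub>R e) = g x"
  shows "(\<integral>\<^sup>+ x. f (x + g x *\<^sub>R e) \<partial>lborel) = (\<integral>\<^sup>+ x. f x \<partial>lborel)"
proof -
  let ?\<phi> = "indicator {0..1::real} :: real \<Rightarrow> ennreal"
  have one: "(\<integral>\<^sup>+ s. ?\<phi> (s - r) \<partial>lborel) = 1" for r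
    using nn_integral_lborel_translate[of ?\<phi> "- r"] by simp
  have "(\<integral>\<^sup>+ x. f (x + g x *\<^sub>R e) \<partial>lborel)
      = (\<integral>\<^sup>+ x. \<integral>\<^sup>+ s. ?\<phi> s * f (x + g x *\<^sub>R e) \<partial>lborel \<partial>lborel)"
    using one[of 0] by (simp add: nn_integral_multc)
  also have "\<dots> = (\<integral>\<^sup>+ s. \<integral>\<^sup>+ x. ?\<phi> s * f (x + g x *\<^sub>R e) \<partial>lborel \<partial>lborel)"
    by (rule lborel_pair.Fubini') measurable
  also have "\<dots> = (\<integral>\<^sup>+ s. \<integral>\<^sup>+ x. ?\<phi> s * f (x + (s + g x) *\<^sub>R e) \<partial>lborel \<partial>lborel)"
  proof (rule nn_integral_cong)
    fix s :: real
    show "(\<integral>\<^sup>+ x. ?\<phi> s * f (x + g x *\<^sub>R e) \<partial>lborel)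
        = (\<integral>\<^sup>+ x. ?\<phi> s * f (x + (s + g x) *\<^sub>R e) \<partial>lborel)"
      using nn_integral_lborel_translate[of "\<lambda>x. ?\<phi> s * f (x + g x *\<^sub>R e)" "s *\<^sub>R e"] inv
      by (simp add: algebra_simps)
  qed
  also have "\<dots> = (\<integral>\<^sup>+ x. \<integral>\<^sup>+ s. ?\<phi> s * f (x + (s + g x) *\<^sub>R e) \<partial>lborel \<partial>lborel)"
    by (rule lborel_pair.Fubini') measurable
  \<comment> \<open>Shifting \<open>s\<close> by \<open>g x\<close> moves \<open>g\<close> out of
    the argument of \<open>f\<close> into the weight. There it is invariant under translation along
    \<open>e\<close>, so the translation by \<open>s\<close> can be undone and the weight integrates
    to 1.\<close>
  also have "\<dots> = (\<integral>\<^sup>+ x. \<integral>\<^sup>+ s. ?\<phi> (s - g x) * f (x + s *\<^sub>R e) \<partial>lborel \<partial>lborel)"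
  proof (rule nn_integral_cong)
    fix x :: 'a
    show "(\<integral>\<^sup>+ s. ?\<phi> s * f (x + (s + g x) *\<^sub>R e) \<partial>lborel)
        = (\<integral>\<^sup>+ s. ?\<phi> (s - g x) * f (x + s *\<^sub>R e) \<partial>lborel)"
      using nn_integral_lborel_translate[of "\<lambda>s. ?\<phi> s * f (x + (s + g x) *\<^sub>R e)" "- g x"]
      by simp
  qed
  also have "\<dots> = (\<integral>\<^sup>+ s. \<integral>\<^sup>+ x. ?\<phi> (s - g x) * f (x + s *\<^sub>R e) \<partial>lborel \<partial>lborel)"
    by (rule lborel_pair.Fubini') measurable
  also have "\<dots> = (\<integral>\<^sup>+ s. \<integral>\<^sup>+ x. ?\<phi> (s - g x) * f x \<partial>lborel \<partial>lborel)"
  proof (rule nn_integral_cong)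
    fix s :: real
    have "g (x - s *\<^sub>R e) = g x" for x
      using inv[of "x - s *\<^sub>R e" s] by simp
    then show "(\<integral>\<^sup>+ x. ?\<phi> (s - g x) * f (x + s *\<^sub>R e) \<partial>lborel) = (\<integral>\<^sup>+ x. ?\<phi> (s - g x) * f x \<partial>lborel)"
      using nn_integral_lborel_translate[of "\<lambda>x. ?\<phi> (s - g x) * f (x + s *\<^sub>R e)" "- (s *\<^sub>R e)"]
      by simp
  qed
  also have "\<dots> = (\<integral>\<^sup>+ x. \<integral>\<^sup>+ s. ?\<phi> (s - g x) * f x \<partial>lborel \<partial>lborel)"
    by (rule lborel_pair.Fubini') measurable
  also have "\<dots> = (\<integral>\<^sup>+ x. f x \<partial>lborel)"
    by (simp add: nn_integral_multc one)
  finally show ?thesis .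
qed

section \<open>Elementary matrices and the determinant formula\<close>

lemma borel_measurable_matrix_vector_mult [measurable (raw)]:
  fixes A :: "real^'n^'m"
  assumes "f \<in> borel_measurable M"
  shows "(\<lambda>x. A *v f x) \<in> borel_measurable M"
  using assms by (rule borel_measurable_continuous_on[rotated])
    (intro linear_continuous_on linear_linear[THEN iffD2] matrix_vector_mul_linear)

lemma det_elementary_shear:
  fixes m n :: "'n::finite"
  assumes "m \<noteq> n"
  shows "det (\<chi> i j. if i = m \<and> j = n then c else of_bool (i = j) :: real^'n^'n) = 1"
proof -
  have "(\<chi> i j. if i = m \<and> j = n then c else of_bool (i = j) :: real^'n^'n)
      = (\<chi> k. if k = m then row m (mat 1) + c *s row n (mat 1) else row k (mat 1))"
    using assms by (auto simp: vec_eq_iff row_def mat_def)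
  then show ?thesis using det_row_operation[OF assms, of "mat 1 :: real^'n^'n" c] by simp
qed

lemma elementary_shear_mult_vec:
  fixes m n :: "'n::finite" and x :: "real^'n"
  assumes "m \<noteq> n"
  shows "(\<chi> i j. if i = m \<and> j = n then c else of_bool (i = j)) *v x = x + (c * x $ n) *\<^sub>R axis m 1"
proof -
  have "(\<Sum>j\<in>UNIV. (if i = m \<and> j = n then c else of_bool (i = j)) * x $ j)
      = (\<Sum>j\<in>UNIV. (if j = i then x $ j else 0) + (if j = n then (if i = m then c * x $ n else 0) else 0))" for i
    using assms by (intro sum.cong) auto
  then show ?thesis
    by (auto simp: vec_eq_iff matrix_vector_mult_def sum.distrib axis_def)
qed

text \<open>Lebesgue measure is determined by its values on boxes, and a permutation of coordinates
  pulls a box back to the box with permuted corners, whose side lengths have the same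
  product.\<close>

lemma lborel_distr_permute:
  fixes p :: "'n::finite \<Rightarrow> 'n"
  assumes p: "p permutes UNIV"
  shows "distr lborel borel (\<lambda>x::real^'n. \<chi> i. x $ p i) = lborel"
proof (rule lborel_eqI[symmetric])
  let ?q = "inv p"
  have meas[measurable]: "(\<lambda>x::real^'n. \<chi> i. x $ p i) \<in> borel_measurable borel"
    by (intro borel_measurable_continuous_onI continuous_intros)
  fix l u :: "real^'n"
  assume le: "\<And>b. b \<in> Basis \<Longrightarrow> l \<bullet> b \<le> u \<bullet> b"
  have le': "l $ i \<le> u $ i" for i
    using le[of "axis i 1"] by (simp add: inner_axis axis_in_Basis_iff)
  have pq: "p (?q i) = i" "?q (p i) = i" for i
    using p by (simp_all add: permutes_inverses)
  have "(\<lambda>x::real^'n. \<chi> i. x $ p i) -` box l u = box (\<chi> i. l $ ?q i) (\<chi> i. u $ ?q i)"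
    by (auto simp: mem_box_cart) (metis pq)+
  then have "emeasure (distr lborel borel (\<lambda>x::real^'n. \<chi> i. x $ p i)) (box l u)
      = emeasure lborel (box (\<chi> i. l $ ?q i) (\<chi> i. u $ ?q i))"
    by (subst emeasure_distr) auto
  also have "\<dots> = (\<Prod>i\<in>UNIV. u $ ?q i - l $ ?q i)"
    using le' by (subst emeasure_lborel_box)
      (auto simp: Basis_vec_def inner_axis axis_eq_axis UNION_singleton_eq_range prod.reindex inj_on_def)
  also have "(\<Prod>i\<in>UNIV. u $ ?q i - l $ ?q i) = (\<Prod>i\<in>UNIV. u $ i - l $ i)"
    using prod.permute[OF permutes_inv[OF p], of "\<lambda>i. u $ i - l $ i"] by (simp add: o_def)
  also have "\<dots> = (\<Prod>b\<in>Basis. (u - l) \<bullet> b)"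
    by (auto simp: Basis_vec_def inner_axis axis_eq_axis UNION_singleton_eq_range prod.reindex inj_on_def)
  finally show "emeasure (distr lborel borel (\<lambda>x::real^'n. \<chi> i. x $ p i)) (box l u)
      = (\<Prod>b\<in>Basis. (u - l) \<bullet> b)" .
qed simp

text \<open>Induction over products of elementary matrices: diagonal matrices rescale the axes,
  transpositions permute them, and the remaining generators are shears. With the determinant as a
  factor no division in \<open>ennreal\<close> occurs.\<close>

lemma nn_integral_lborel_matrix:
  fixes A :: "real^'n^'n" and f :: "real^'n \<Rightarrow> ennreal"
  assumes "det A \<noteq> 0" "f \<in> borel_measurable borel"
  shows "\<bar>det A\<bar> * (\<integral>\<^sup>+ x. f (A *v x) \<partial>lborel) = (\<integral>\<^sup>+ x. f x \<partial>lborel)"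
proof -
  \<comment> \<open>The function is quantified inside the induction predicate because the product
    case applies the hypothesis for the right factor to \<open>f\<close> composed with the left one.
    The premise on the determinant disposes of matrices with a zero row.\<close>
  have "det A \<noteq> 0 \<longrightarrow> (\<forall>f \<in> borel_measurable borel.
      \<bar>det A\<bar> * (\<integral>\<^sup>+ x. f (A *v x) \<partial>lborel) = (\<integral>\<^sup>+ x. f x \<partial>lborel))"
  proof (rule induct_matrix_elementary, goal_cases)
    case (1 A B)
    show ?case
    proof (intro impI ballI)
      fix f :: "real^'n \<Rightarrow> ennreal"
      assume nz: "det (A ** B) \<noteq> 0" and f [measurable]: "f \<in> borel_measurable borel"
      have nzA: "det A \<noteq> 0" and nzB: "det B \<noteq> 0" using nz by (auto simp: det_mul)
      have "\<bar>det (A ** B)\<bar> * (\<integral>\<^sup>+ x. f (A ** B *v x) \<partial>lborel)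
          = \<bar>det A\<bar> * (\<bar>det B\<bar> * (\<integral>\<^sup>+ x. (\<lambda>x. f (A *v x)) (B *v x) \<partial>lborel))"
        by (simp add: det_mul abs_mult ennreal_mult mult.assoc matrix_vector_mul_assoc)
      also have "\<bar>det B\<bar> * (\<integral>\<^sup>+ x. (\<lambda>x. f (A *v x)) (B *v x) \<partial>lborel) = (\<integral>\<^sup>+ x. f (A *v x) \<partial>lborel)"
        using 1(2) nzB by (intro bspec[of _ _ "\<lambda>x. f (A *v x)"]) auto
      also have "\<bar>det A\<bar> * \<dots> = (\<integral>\<^sup>+ x. f x \<partial>lborel)"
        using 1(1) nzA f by blast
      finally show "\<bar>det (A ** B)\<bar> * (\<integral>\<^sup>+ x. f (A ** B *v x) \<partial>lborel) = (\<integral>\<^sup>+ x. f x \<partial>lborel)" .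
    qed
  next
    case (2 A i)
    then show ?case using det_zero_row by auto
  next
    case (3 A)
    show ?case
    proof (intro impI ballI)
      fix f :: "real^'n \<Rightarrow> ennreal"
      assume nz: "det A \<noteq> 0" and f [measurable]: "f \<in> borel_measurable borel"
      have dA: "det A = (\<Prod>i\<in>UNIV. A $ i $ i)" using 3 by (rule det_diagonal)
      then have nzi: "A $ i $ i \<noteq> 0" for i using nz by auto
      \<comment> \<open>\<open>lborel_affine_euclidean\<close> takes its scaling factors as a
        function of basis vectors; this linear functional returns the diagonal entry
        \<open>A $ i $ i\<close> at \<open>axis i 1\<close>.\<close>
      define c where "c = (\<lambda>b. \<Sum>i\<in>UNIV. A $ i $ i * b $ i)"
      have c_axis: "c (axis i 1) = A $ i $ i" for i
        by (simp add: c_def axis_def if_distrib cong: if_cong)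
      have axis_nth: "(axis j 1 :: real^'n) $ i = (if j = i then 1 else 0)" for i j
        by (simp add: axis_def)
      have img: "Basis = range (\<lambda>i. axis i 1 :: real^'n)"
        by (auto simp: Basis_vec_def)
      have inj: "inj (\<lambda>i. axis i 1 :: real^'n)" by (auto simp: inj_on_def axis_eq_axis)
      have Av: "A *v x = 0 + (\<Sum>j\<in>Basis. (c j * (x \<bullet> j)) *\<^sub>R j)" for x
      proof -
        have "(A *v x) $ i = A $ i $ i * x $ i" for i
        proof -
          have "(\<Sum>j\<in>UNIV. A $ i $ j * x $ j) = (\<Sum>j\<in>UNIV. if j = i then A $ i $ i * x $ i else 0)"
            using 3 by (intro sum.cong) auto
          then show ?thesis by (simp add: matrix_vector_mult_def)
        qed
        moreover have "(\<Sum>j\<in>Basis. (c j * (x \<bullet> j)) *\<^sub>R j) $ i = A $ i $ i * x $ i" for i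
          unfolding img by (subst sum.reindex[OF inj])
            (simp add: c_axis inner_axis axis_nth if_distrib cong: if_cong)
        ultimately show ?thesis by (simp add: vec_eq_iff)
      qed
      have pc: "(\<Prod>j\<in>Basis. \<bar>c j\<bar>) = \<bar>det A\<bar>"
        unfolding img by (subst prod.reindex[OF inj]) (simp add: c_axis dA abs_prod)
      have "lborel = density (distr lborel borel (\<lambda>x. A *v x)) (\<lambda>_. \<bar>det A\<bar>)"
        unfolding Av pc[symmetric]
        by (rule lborel_affine_euclidean) (auto simp: img c_axis nzi)
      then have "(\<integral>\<^sup>+ x. f x \<partial>lborel)
          = (\<integral>\<^sup>+ x. f x \<partial>density (distr lborel borel (\<lambda>x. A *v x)) (\<lambda>_. ennreal \<bar>det A\<bar>))"
        by simp
      also have "\<dots> = \<bar>det A\<bar> * (\<integral>\<^sup>+ x. f (A *v x) \<partial>lborel)"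
        by (simp add: nn_integral_density nn_integral_distr nn_integral_cmult)
      finally show "\<bar>det A\<bar> * (\<integral>\<^sup>+ x. f (A *v x) \<partial>lborel) = (\<integral>\<^sup>+ x. f x \<partial>lborel)" by simp
    qed
  next
    case (4 m n)
    let ?p = "Transposition.transpose m n"
    have p: "?p permutes UNIV" by (simp add: permutes_swap_id)
    let ?S = "(\<chi> i j. mat 1 $ i $ ?p j) :: real^'n^'n"
    have d: "\<bar>det ?S\<bar> = 1"
      using det_permute_columns[OF p, of "mat 1 :: real^'n^'n"] by (simp add: sign_def)
    have Sv: "?S *v x = (\<chi> i. x $ ?p i)" for x
    proof -
      have "(\<Sum>j\<in>UNIV. (mat 1 :: real^'n^'n) $ i $ ?p j * x $ j) = (\<Sum>j\<in>UNIV. if j = ?p i then x $ j else 0)" for i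
        by (intro sum.cong) (auto simp: mat_def)
      then show ?thesis by (simp add: vec_eq_iff matrix_vector_mult_def)
    qed
    have meas[measurable]: "(\<lambda>x::real^'n. \<chi> i. x $ ?p i) \<in> borel_measurable borel"
      by (intro borel_measurable_continuous_onI continuous_intros)
    show ?case
    proof (intro impI ballI)
      fix f :: "real^'n \<Rightarrow> ennreal"
      assume f [measurable]: "f \<in> borel_measurable borel"
      have "(\<integral>\<^sup>+ x. f x \<partial>lborel) = (\<integral>\<^sup>+ x. f x \<partial>distr lborel borel (\<lambda>x. \<chi> i. x $ ?p i))"
        by (simp add: lborel_distr_permute[OF p])
      also have "\<dots> = (\<integral>\<^sup>+ x. f (\<chi> i. x $ ?p i) \<partial>lborel)"
        by (subst nn_integral_distr) auto
      finally show "\<bar>det ?S\<bar> * (\<integral>\<^sup>+ x. f (?S *v x) \<partial>lborel) = (\<integral>\<^sup>+ x. f x \<partial>lborel)"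
        by (simp only: d Sv) simp
    qed
  next
    case (5 m n c)
    show ?case
    proof (intro impI ballI)
      fix f :: "real^'n \<Rightarrow> ennreal"
      assume f [measurable]: "f \<in> borel_measurable borel"
      have "(\<integral>\<^sup>+ x. f (x + (c * x $ n) *\<^sub>R axis m 1) \<partial>lborel) = (\<integral>\<^sup>+ x. f x \<partial>lborel)"
      proof (rule nn_integral_lborel_shear[OF f])
        show "(\<lambda>x::real^'n. c * x $ n) \<in> borel_measurable borel"
          by (intro borel_measurable_continuous_onI continuous_intros)
      qed (use 5 in \<open>simp add: axis_def\<close>)
      then show "\<bar>det (\<chi> i j. if i = m \<and> j = n then c else of_bool (i = j) :: real^'n^'n)\<bar>
          * (\<integral>\<^sup>+ x. f ((\<chi> i j. if i = m \<and> j = n then c else of_bool (i = j)) *v x) \<partial>lborel)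
          = (\<integral>\<^sup>+ x. f x \<partial>lborel)"
        by (simp only: det_elementary_shear[OF 5] elementary_shear_mult_vec[OF 5]) simp
    qed
  qed
  with assms show ?thesis by blast
qed

section \<open>Gaussian integrals\<close>

lemma matrix_inv:
  fixes A :: "real^'n^'n"
  assumes "invertible A"
  shows matrix_inv_right: "A ** matrix_inv A = mat 1"
    and matrix_inv_left: "matrix_inv A ** A = mat 1"
  using someI_ex[OF assms[unfolded invertible_def]] by (auto simp: matrix_inv_def)

lemma matrix_inv_eqI:
  fixes A B :: "real^'n^'n"
  assumes "A ** B = mat 1"
  shows "matrix_inv A = B"
proof -
  have "invertible A" using assms matrix_left_right_inverse by (auto simp: invertible_def)
  then have "matrix_inv A = matrix_inv A ** (A ** B)" using assms by simp
  also have "\<dots> = B" using \<open>invertible A\<close> by (simp add: matrix_mul_assoc matrix_inv_left)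
  finally show ?thesis .
qed

lemma inner_matrix_transpose:
  fixes A :: "real^'n^'m"
  shows "x \<bullet> (A *v y) = (transpose A *v x) \<bullet> y"
  by (metis dot_lmul_matrix vector_transpose_matrix transpose_transpose matrix_transpose_mul)

section \<open>Positive definite matrices and Gaussian normalisation\<close>

lemma pos_def_commute: "pos_def M \<Longrightarrow> x \<bullet> (M *v y) = y \<bullet> (M *v x)"
  by (metis inner_commute inner_matrix_transpose pos_def_def)

lemma pos_def_nonneg: "pos_def M \<Longrightarrow> 0 \<le> x \<bullet> (M *v x)"
  by (cases "x = 0") (auto simp: pos_def_def less_imp_le)

text \<open>Gram-Schmidt for the inner product defined by \<open>M\<close>, adding one index at a
  time; the vectors become the columns of \<open>V\<close>. The frame plays the part of an inverse
  square root of \<open>M\<close>: it yields the sign of the determinant and reduces Gaussian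
  integrals to the standard one.\<close>

lemma pos_def_orthonormal_frame:
  fixes M :: "real^'n^'n"
  assumes M: "pos_def M"
  shows "\<exists>V::real^'n^'n. transpose V ** M ** V = mat 1"
proof -
  have "\<exists>v. \<forall>i\<in>I. \<forall>j\<in>I. v i \<bullet> (M *v v j) = of_bool (i = j)" for I :: "'n set"
  proof (induction rule: finite_induct[OF finite[of I]])
    case 1
    then show ?case by simp
  next
    case (2 k I)
    then obtain v where v: "\<And>i j. i \<in> I \<Longrightarrow> j \<in> I \<Longrightarrow> v i \<bullet> (M *v v j) = of_bool (i = j)" by blast
    \<comment> \<open>Being \<open>M\<close>-orthogonal to the earlier vectors means being
      Euclidean-orthogonal to their images under \<open>M\<close>. These are fewer than the
      dimension, so a nonzero such vector exists; it is then scaled to unit \<open>M\<close>-length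
      by \<open>r\<close>.\<close>
    let ?S = "(\<lambda>i. M *v v i) ` I"
    have "dim ?S \<le> card ?S" by (intro dim_le_card') auto
    also have "\<dots> \<le> card I" by (intro card_image_le) auto
    also have "\<dots> < CARD('n)" using 2 by (intro psubset_card_mono) auto
    finally have "dim ?S < DIM(real^'n)" by simp
    then obtain x where x: "x \<noteq> 0" "\<And>y. y \<in> span ?S \<Longrightarrow> orthogonal x y"
      using orthogonal_to_subspace_exists by blast
    have xi: "x \<bullet> (M *v v i) = 0" if "i \<in> I" for i
      using x(2)[of "M *v v i"] that by (auto simp: orthogonal_def intro: span_base)
    have pos: "x \<bullet> (M *v x) > 0" using M x by (auto simp: pos_def_def)
    define r where "r = inverse (sqrt (x \<bullet> (M *v x)))"
    have r: "r * (r * (x \<bullet> (M *v x))) = 1"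
      using pos by (simp add: r_def field_simps)
    define w where "w = (\<lambda>i. if i = k then r *\<^sub>R x else v i)"
    have "w i \<bullet> (M *v w j) = of_bool (i = j)" if "i \<in> insert k I" "j \<in> insert k I" for i j
      using that 2(2) v xi r pos_def_commute[OF M, of "v i" x]
      by (auto simp: w_def matrix_vector_mult_scaleR)
    then show ?case by blast
  qed
  from this[of UNIV] obtain v :: "'n \<Rightarrow> real^'n" where v: "\<And>i j. v i \<bullet> (M *v v j) = of_bool (i = j)" by blast
  define V where "V = (\<chi> i j. v j $ i)"
  have "(transpose V ** (M ** V)) $ i $ j = v i \<bullet> (M *v v j)" for i j
    by (simp add: V_def transpose_def matrix_matrix_mult_def matrix_vector_mult_def inner_vec_def)
  then have "transpose V ** M ** V = mat 1"
    by (simp add: vec_eq_iff v mat_def matrix_mul_assoc)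
  then show ?thesis by blast
qed

lemma pos_def_det_pos:
  fixes M :: "real^'n^'n"
  assumes "pos_def M"
  shows "det M > 0"
proof -
  obtain V :: "real^'n^'n" where V: "transpose V ** M ** V = mat 1" using pos_def_orthonormal_frame[OF assms] by blast
  have "det V * det M * det V = 1"
    using arg_cong[OF V, of det] by (simp add: det_mul det_transpose)
  then have "(det V)\<^sup>2 * det M = 1" by (simp add: power2_eq_square ac_simps)
  then show ?thesis
    by (metis zero_less_mult_pos zero_less_one zero_less_power2 mult_eq_0_iff power_zero_numeral zero_neq_one)
qed

lemma pos_def_invertible:
  fixes M :: "real^'n^'n"
  shows "pos_def M \<Longrightarrow> invertible M"
  using pos_def_det_pos[of M] by (simp add: invertible_det_nz)

lemma pos_def_matrix_inv:
  fixes M :: "real^'n^'n"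
  assumes M: "pos_def M"
  shows "pos_def (matrix_inv M)"
proof -
  let ?N = "matrix_inv M"
  note inv = matrix_inv[OF pos_def_invertible[OF M]]
  have "transpose ?N ** M = mat 1"
    using arg_cong[OF inv(1), of transpose] M by (simp add: matrix_transpose_mul pos_def_def transpose_mat)
  then have t: "transpose ?N = ?N"
    by (metis inv(1) matrix_mul_assoc matrix_mul_lid matrix_mul_rid)
  have "x \<bullet> (?N *v x) > 0" if "x \<noteq> 0" for x
  proof -
    have xe: "M *v (?N *v x) = x" by (simp add: matrix_vector_mul_assoc inv)
    then have "?N *v x \<noteq> 0" using that by auto
    then have "(?N *v x) \<bullet> (M *v (?N *v x)) > 0" using M by (simp add: pos_def_def)
    then show ?thesis by (simp add: xe inner_commute)
  qed
  with t show ?thesis by (simp add: pos_def_def)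
qed

lemma nn_integral_std_gauss:
  "(\<integral>\<^sup>+ z. ennreal (exp (- (z \<bullet> (z::real^'n)) / 2)) \<partial>lborel) = ennreal (sqrt ((2 * pi) ^ CARD('n)))"
proof -
  have one: "(\<integral>\<^sup>+ s. ennreal (exp (- (s::real)\<^sup>2 / 2)) \<partial>lborel) = ennreal (sqrt (2 * pi))"
  proof -
    have "(\<integral>\<^sup>+ s. ennreal (exp (- (s::real)\<^sup>2 / 2)) \<partial>lborel)
        = (\<integral>\<^sup>+ s. ennreal (sqrt (2 * pi)) * ennreal (std_normal_density s) \<partial>lborel)"
      by (intro nn_integral_cong) (simp add: std_normal_density_def ennreal_mult[symmetric])
    also have "\<dots> = ennreal (sqrt (2 * pi)) * (\<integral>\<^sup>+ s. ennreal (std_normal_density s) \<partial>lborel)"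
      by (intro nn_integral_cmult) simp
    also have "(\<integral>\<^sup>+ s. ennreal (std_normal_density s) \<partial>lborel) = 1"
      by (subst nn_integral_eq_integral) auto
    finally show ?thesis by simp
  qed
  have "ennreal (exp (- (z \<bullet> z) / 2)) = (\<Prod>b\<in>Basis. ennreal (exp (- (z \<bullet> b)\<^sup>2 / 2)))" for z :: "real^'n"
    by (subst prod_ennreal)
      (auto simp: exp_sum[symmetric] euclidean_inner[of z z] power2_eq_square sum_negf sum_divide_distrib)
  then have "(\<integral>\<^sup>+ z. ennreal (exp (- (z \<bullet> (z::real^'n)) / 2)) \<partial>lborel)
      = (\<Prod>b\<in>(Basis :: (real^'n) set). \<integral>\<^sup>+ s. ennreal (exp (- s\<^sup>2 / 2)) \<partial>lborel)"
    by (simp only:) (rule nn_integral_lborel_prod, auto)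
  also have "\<dots> = ennreal (sqrt ((2 * pi) ^ CARD('n)))"
    unfolding one by (simp add: ennreal_power real_sqrt_power real_sqrt_mult power_mult_distrib)
  finally show ?thesis .
qed

text \<open>The substitution y = m + V z by the orthonormal frame turns the form into z . z, and the
  Jacobian is |det V| = 1 / sqrt (det M).\<close>

lemma nn_integral_exp_quadratic:
  fixes M :: "real^'n^'n"
  assumes M: "pos_def M"
  shows "(\<integral>\<^sup>+ y. ennreal (exp (- ((y - m) \<bullet> (M *v (y - m))) / 2)) \<partial>lborel)
       = ennreal (sqrt ((2 * pi) ^ CARD('n) / det M))"
proof -
  obtain V :: "real^'n^'n" where V: "transpose V ** M ** V = mat 1" using pos_def_orthonormal_frame[OF M] by blast
  have "det V * det M * det V = 1"
    using arg_cong[OF V, of det] by (simp add: det_mul det_transpose)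
  then have sq: "(det V)\<^sup>2 = 1 / det M" using pos_def_det_pos[OF M]
    by (simp add: power2_eq_square field_simps)
  then have nz: "det V \<noteq> 0" using pos_def_det_pos[OF M] by auto
  have dV: "\<bar>det V\<bar> = sqrt (1 / det M)" using sq by (metis real_sqrt_abs)
  let ?f = "\<lambda>y. ennreal (exp (- (y \<bullet> (M *v y)) / 2))"
  have quad: "(V *v z) \<bullet> (M *v (V *v z)) = z \<bullet> z" for z
    using V by (metis inner_matrix_transpose inner_commute matrix_vector_mul_assoc matrix_vector_mul_lid)
  have [measurable]: "?f \<in> borel_measurable borel" by measurable
  have "(\<integral>\<^sup>+ y. ennreal (exp (- ((y - m) \<bullet> (M *v (y - m))) / 2)) \<partial>lborel) = (\<integral>\<^sup>+ y. ?f y \<partial>lborel)"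
    using nn_integral_lborel_translate[of ?f "- m"] by simp
  also have "\<dots> = \<bar>det V\<bar> * (\<integral>\<^sup>+ z. ?f (V *v z) \<partial>lborel)"
    using nz by (intro nn_integral_lborel_matrix[symmetric]) auto
  also have "\<dots> = ennreal \<bar>det V\<bar> * ennreal (sqrt ((2 * pi) ^ CARD('n)))"
    by (simp only: quad nn_integral_std_gauss)
  also have "\<dots> = ennreal (sqrt ((2 * pi) ^ CARD('n) / det M))"
    using pos_def_det_pos[OF M]
    by (simp add: dV ennreal_mult[symmetric] real_sqrt_mult[symmetric] mult.commute)
  finally show ?thesis .
qed

lemma det_matrix_inv:
  fixes M :: "real^'n^'n"
  assumes "invertible M"
  shows "det (matrix_inv M) = 1 / det M"
  using arg_cong[OF matrix_inv_right[OF assms], of det] assms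
  by (auto simp: det_mul invertible_det_nz field_simps)

lemma gauss_density_pos: "pos_def S \<Longrightarrow> 0 < gauss_density m S y"
  by (simp add: gauss_density_def pos_def_det_pos)

lemma nn_integral_gauss_density:
  fixes S :: "real^'n^'n"
  assumes S: "pos_def S"
  shows "(\<integral>\<^sup>+ y. ennreal (gauss_density m S y) \<partial>lborel) = 1"
proof -
  have d: "det S > 0" by (rule pos_def_det_pos[OF S])
  let ?c = "sqrt ((2 * pi) ^ CARD('n) * det S)"
  have c: "?c > 0" using d by simp
  have "(\<integral>\<^sup>+ y. ennreal (gauss_density m S y) \<partial>lborel)
      = (\<integral>\<^sup>+ y. ennreal (1 / ?c) * ennreal (exp (- ((y - m) \<bullet> (matrix_inv S *v (y - m))) / 2)) \<partial>lborel)"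
    using c by (intro nn_integral_cong) (simp add: gauss_density_def ennreal_mult[symmetric])
  also have "\<dots> = ennreal (1 / ?c) * ennreal (sqrt ((2 * pi) ^ CARD('n) / det (matrix_inv S)))"
    by (subst nn_integral_cmult)
      (measurable, simp only: nn_integral_exp_quadratic[OF pos_def_matrix_inv[OF S]])
  also have "\<dots> = ennreal (1 / ?c * ?c)"
    using d c by (simp add: det_matrix_inv[OF pos_def_invertible[OF S]] ennreal_mult[symmetric] del: divide_self_if)
  also have "1 / ?c * ?c = 1" using c d by simp
  finally show ?thesis by simp
qed

section \<open>The Riccati step\<close>

lemma transpose_diff: "transpose (X - Y) = transpose X - transpose (Y :: real^'n^'m)"
  by (simp add: transpose_def vec_eq_iff)

lemma transpose_add: "transpose (X + Y) = transpose X + transpose (Y :: real^'n^'m)"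
  by (simp add: transpose_def vec_eq_iff)

lemma transpose_scaleR: "transpose (c *\<^sub>R X) = c *\<^sub>R transpose (X :: real^'n^'m)"
  by (simp add: transpose_def vec_eq_iff)

lemma matrix_mul_scaleR_left: "(c *\<^sub>R X) ** Y = c *\<^sub>R (X ** (Y :: real^'n^'m))"
  by (simp add: matrix_matrix_mult_def vec_eq_iff sum_distrib_left mult.assoc)

lemma matrix_mul_scaleR_right: "X ** (c *\<^sub>R Y) = c *\<^sub>R (X ** (Y :: real^'n^'m))"
  by (simp add: matrix_matrix_mult_def vec_eq_iff sum_distrib_left mult.left_commute)

lemma matrix_mul_diff_left: "(X - Y) ** Z = X ** Z - Y ** (Z :: real^'n^'m)"
  by (simp add: matrix_matrix_mult_def vec_eq_iff sum_subtractf left_diff_distrib)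

lemma matrix_mul_diff_right: "Z ** (X - Y) = Z ** X - Z ** (Y :: real^'n^'m)"
  by (simp add: matrix_matrix_mult_def vec_eq_iff sum_subtractf right_diff_distrib)

lemma matrix_mul_add_left: "(X + Y) ** Z = X ** Z + Y ** (Z :: real^'n^'m)"
  by (simp add: matrix_matrix_mult_def vec_eq_iff sum.distrib distrib_right)

lemma matrix_mul_add_right: "Z ** (X + Y) = Z ** X + Z ** (Y :: real^'n^'m)"
  by (simp add: matrix_matrix_mult_def vec_eq_iff sum.distrib distrib_left)

lemma inner_vector_matrix: "u \<bullet> (w v* X) = ((X :: real^'n^'m) *v u) \<bullet> w"
  by (metis dot_lmul_matrix inner_commute)

lemma matrix_vector_scaleR: "(c *\<^sub>R X) *v v = c *\<^sub>R ((X :: real^'n^'m) *v v)"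
  by (simp add: matrix_vector_mult_def vec_eq_iff sum_distrib_left mult.assoc)

lemma matrix_inv_cancel:
  fixes G :: "real^'n^'n"
  assumes "invertible G"
  shows "G *v (matrix_inv G *v z) = z" "matrix_inv G *v (G *v z) = z"
  using assms by (simp_all add: matrix_vector_mul_assoc matrix_inv)

lemma quadratic_form_add:
  fixes M :: "real^'n^'n"
  assumes "transpose M = M"
  shows "(x + y) \<bullet> (M *v (x + y)) = x \<bullet> (M *v x) + 2 * (x \<bullet> (M *v y)) + y \<bullet> (M *v y)"
proof -
  have "y \<bullet> (M *v x) = x \<bullet> (M *v y)" using assms by (metis inner_commute inner_matrix_transpose)
  then show ?thesis by (simp add: matrix_vector_right_distrib inner_add_left inner_add_right)
qed

lemma quadratic_form_diff:
  fixes M :: "real^'n^'n"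
  assumes "transpose M = M"
  shows "(x - y) \<bullet> (M *v (x - y)) = x \<bullet> (M *v x) - 2 * (x \<bullet> (M *v y)) + y \<bullet> (M *v y)"
proof -
  have "y \<bullet> (M *v x) = x \<bullet> (M *v y)" using assms by (metis inner_commute inner_matrix_transpose)
  then show ?thesis by (simp add: matrix_vector_mult_diff_distrib inner_diff_left inner_diff_right)
qed

text \<open>Multiply the hypothesis \<open>PG\<close> by the inverse of \<open>G\<close> on the
  right and by its transpose on the left. It serves twice: with \<open>N\<close> for the symmetry of
  \<open>W\<close>, and with \<open>G\<close> for the symmetry of the Riccati update.\<close>

lemma transpose_mult_matrix_inv:
  fixes P G :: "real^'n^'n"
  assumes P: "transpose P = P" and G: "invertible G" and PG: "transpose G ** P = P ** G"
  shows "transpose (P ** matrix_inv G) = P ** matrix_inv G"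
proof -
  have "transpose (matrix_inv G) ** transpose G = mat 1"
    using arg_cong[OF matrix_inv_right[OF G], of transpose] by (simp add: matrix_transpose_mul transpose_mat)
  then have "transpose (matrix_inv G) ** P = transpose (matrix_inv G) ** (P ** G) ** matrix_inv G"
    by (simp add: PG[symmetric] matrix_mul_assoc)
       (metis (no_types, lifting) G PG matrix_inv_right matrix_mul_assoc matrix_mul_lid matrix_mul_rid)
  also have "\<dots> = P ** matrix_inv G"
    using \<open>transpose (matrix_inv G) ** transpose G = mat 1\<close> by (simp add: PG[symmetric] matrix_mul_assoc)
  finally show ?thesis by (simp add: matrix_transpose_mul P)
qed

text \<open>\<open>M\<close> is the precision of the next state after tilting its Gaussian law by \<open>exp (\<eta> y\<^sup>T P y / 2)\<close>, and \<open>W\<close>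
  the Hessian of the resulting risk-adjusted cost in the mean of the next state. Below, \<open>K\<close> is the
  precision of the optimal control and \<open>P'\<close> the Riccati update of \<open>P\<close>.\<close>

context
  fixes \<eta> :: real and \<Sigma> P M N W :: "real^'n^'n"
  assumes eta: "\<eta> \<noteq> 0"
    and Sigma: "pos_def \<Sigma>" and P: "pos_def P" and M: "pos_def M"
    and M_def: "M = matrix_inv \<Sigma> - \<eta> *\<^sub>R P"
    and N_def: "N = mat 1 - \<eta> *\<^sub>R (\<Sigma> ** P)"
    and W_def: "W = P ** matrix_inv N"
begin

lemma tilt_factor: "N = \<Sigma> ** M"
  by (simp add: N_def M_def matrix_mul_diff_right matrix_mul_scaleR_right
      matrix_inv_right[OF pos_def_invertible[OF Sigma]])

text \<open>Here the assumption that Sigma^{-1} - eta P is positive definite guarantees the inverse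
  that occurs in the optimal policy.\<close>

lemma tilt_invertible: "invertible N"
  unfolding tilt_factor using Sigma M by (intro invertible_mult pos_def_invertible)

lemma tilt_mult: "N *v h = h - \<eta> *\<^sub>R (\<Sigma> *v (P *v h))"
  by (simp add: N_def matrix_vector_mult_diff_rdistrib matrix_vector_scaleR matrix_vector_mul_assoc)

lemma tilt_symmetric: "transpose W = W"
  unfolding W_def
proof (rule transpose_mult_matrix_inv[OF _ tilt_invertible])
  show "transpose P = P" using P by (simp add: pos_def_def)
  then show "transpose N ** P = P ** N"
    using Sigma by (simp add: N_def transpose_diff transpose_scaleR transpose_mat matrix_transpose_mul
      pos_def_def matrix_mul_diff_left matrix_mul_diff_right matrix_mul_scaleR_left matrix_mul_scaleR_right
      matrix_mul_assoc)
qed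

text \<open>\<open>h m\<close> is the mean of the tilted Gaussian: \<open>M *v h m\<close> equals
  Sigma^{-1} m, which matches the terms linear in \<open>y\<close>. The quadratic terms match by the
  definition of \<open>M\<close>.\<close>

lemma gauss_tilt_complete_square:
  defines "h \<equiv> \<lambda>m. matrix_inv N *v m"
  shows "- ((y - m) \<bullet> (matrix_inv \<Sigma> *v (y - m))) + \<eta> * (y \<bullet> (P *v y))
       = - ((y - h m) \<bullet> (M *v (y - h m))) + \<eta> * (m \<bullet> (W *v m))"
proof -
  let ?h = "h m" and ?T = "matrix_inv \<Sigma>"
  have T: "transpose ?T = ?T" using pos_def_matrix_inv[OF Sigma] by (simp add: pos_def_def)
  have Mt: "transpose M = M" using M by (simp add: pos_def_def)
  have Nh: "N *v ?h = m" by (simp add: h_def matrix_inv_cancel tilt_invertible)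
  then have m: "m = ?h - \<eta> *\<^sub>R (\<Sigma> *v (P *v ?h))"
    by (simp add: tilt_mult)
  have Tm: "?T *v m = M *v ?h"
    using Nh matrix_inv_cancel(2)[OF pos_def_invertible[OF Sigma], of "M *v ?h"]
    by (simp add: tilt_factor matrix_vector_mul_assoc)
  have Wm: "W *v m = P *v ?h" by (simp add: W_def h_def matrix_vector_mul_assoc)
  \<comment> \<open>What remains is to match the terms free of \<open>y\<close>. Since h - m = eta
    Sigma P h and M h = Sigma^{-1} m, the two covariance factors cancel.\<close>
  have "(?h - m) \<bullet> (M *v ?h) = \<eta> * ((\<Sigma> *v (P *v ?h)) \<bullet> (?T *v m))"
    by (subst (1) m) (simp add: Tm)
  also have "\<dots> = \<eta> * ((P *v ?h) \<bullet> m)"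
    by (metis inner_matrix_transpose T inner_commute matrix_inv_cancel(2) pos_def_invertible[OF Sigma])
  finally have key: "?h \<bullet> (M *v ?h) - m \<bullet> (M *v ?h) = \<eta> * (m \<bullet> (P *v ?h))"
    by (simp add: inner_diff_left inner_commute[of "P *v ?h" m])
  have "y \<bullet> (M *v y) = y \<bullet> (?T *v y) - \<eta> * (y \<bullet> (P *v y))"
    by (simp add: M_def matrix_vector_mult_diff_rdistrib matrix_vector_scaleR inner_diff_right)
  with key show ?thesis
    by (simp add: quadratic_form_diff[OF T] quadratic_form_diff[OF Mt] Tm Wm)
qed

text \<open>The two signs of eta need different reasons. For eta > 0, the completed square at y = m
  gives m . W m >= m . P m. For eta < 0, writing m = N h gives m . W m = h . P h - eta (P h) . Sigma
  (P h), a sum of nonnegative terms.\<close>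

lemma tilt_nonneg: "0 \<le> m \<bullet> (W *v m)"
proof -
  let ?h = "matrix_inv N *v m"
  show ?thesis
  proof (cases "\<eta> > 0")
    case True
    have "\<eta> * (m \<bullet> (P *v m)) = - ((m - ?h) \<bullet> (M *v (m - ?h))) + \<eta> * (m \<bullet> (W *v m))"
      using gauss_tilt_complete_square[of m m] by simp
    moreover have "0 \<le> \<eta> * (m \<bullet> (P *v m))" using True pos_def_nonneg[OF P] by simp
    moreover have "0 \<le> (m - ?h) \<bullet> (M *v (m - ?h))" by (rule pos_def_nonneg[OF M])
    ultimately have "0 \<le> \<eta> * (m \<bullet> (W *v m))" by linarith
    then show ?thesis using True by (simp add: zero_le_mult_iff)
  next
    case False
    have m: "m = ?h - \<eta> *\<^sub>R (\<Sigma> *v (P *v ?h))"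
      using matrix_inv_cancel(1)[OF tilt_invertible, of m] by (simp only: tilt_mult)
    have "m \<bullet> (W *v m) = m \<bullet> (P *v ?h)" by (simp add: W_def matrix_vector_mul_assoc)
    also have "\<dots> = ?h \<bullet> (P *v ?h) - \<eta> * ((P *v ?h) \<bullet> (\<Sigma> *v (P *v ?h)))"
      by (subst (1) m) (simp add: inner_diff_left inner_diff_right inner_commute)
    also have "\<dots> \<ge> 0"
      using pos_def_nonneg[OF P, of ?h] pos_def_nonneg[OF Sigma, of "P *v ?h"] False
      by (smt (verit) mult_nonneg_nonneg mult_minus_left)
    finally show ?thesis .
  qed
qed

text \<open>The constant is the quotient of the Gaussian normalisations for \<open>M\<close> and for
  Sigma, that is det N to the power -1/2. It is uniform in \<open>m\<close>, so it depends on
  neither the state nor the control.\<close>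

lemma nn_integral_gauss_tilt:
  "\<exists>\<kappa>>0. \<forall>m. (\<integral>\<^sup>+ y. ennreal (gauss_density m \<Sigma> y) * ennreal (exp (\<eta> * (y \<bullet> (P *v y) / 2))) \<partial>lborel)
       = ennreal (\<kappa> * exp (\<eta> * (m \<bullet> (W *v m) / 2)))"
proof (intro exI conjI allI)
  let ?c = "sqrt ((2 * pi) ^ CARD('n) * det \<Sigma>)" and ?d = "sqrt ((2 * pi) ^ CARD('n) / det M)"
  have c: "?c > 0" and d: "?d > 0" using pos_def_det_pos[OF Sigma] pos_def_det_pos[OF M] by auto
  then show "0 < ?d / ?c" by simp
  fix m
  let ?h = "matrix_inv N *v m"
  let ?w = "exp (\<eta> * (m \<bullet> (W *v m) / 2)) / ?c"
  have "(\<integral>\<^sup>+ y. ennreal (gauss_density m \<Sigma> y) * ennreal (exp (\<eta> * (y \<bullet> (P *v y) / 2))) \<partial>lborel)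
      = (\<integral>\<^sup>+ y. ennreal ?w * ennreal (exp (- ((y - ?h) \<bullet> (M *v (y - ?h))) / 2)) \<partial>lborel)"
  proof (rule nn_integral_cong)
    fix y
    have "exp (- ((y - m) \<bullet> (matrix_inv \<Sigma> *v (y - m))) / 2) * exp (\<eta> * (y \<bullet> (P *v y) / 2))
        = exp ((- ((y - m) \<bullet> (matrix_inv \<Sigma> *v (y - m))) + \<eta> * (y \<bullet> (P *v y))) / 2)"
      by (simp add: exp_add[symmetric] add_divide_distrib diff_divide_distrib)
    also have "\<dots> = exp (- ((y - ?h) \<bullet> (M *v (y - ?h))) / 2) * exp (\<eta> * (m \<bullet> (W *v m) / 2))"
      unfolding gauss_tilt_complete_square by (simp add: exp_add[symmetric] add_divide_distrib diff_divide_distrib)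
    finally have "gauss_density m \<Sigma> y * exp (\<eta> * (y \<bullet> (P *v y) / 2))
        = ?w * exp (- ((y - ?h) \<bullet> (M *v (y - ?h))) / 2)"
      by (simp add: gauss_density_def)
    then show "ennreal (gauss_density m \<Sigma> y) * ennreal (exp (\<eta> * (y \<bullet> (P *v y) / 2)))
        = ennreal ?w * ennreal (exp (- ((y - ?h) \<bullet> (M *v (y - ?h))) / 2))"
      using c gauss_density_pos[OF Sigma, of m y]
      by (simp only: ennreal_mult[symmetric] less_imp_le exp_ge_zero) (subst ennreal_mult[symmetric]; simp)
  qed
  also have "\<dots> = ennreal ?w * ennreal ?d"
    by (subst nn_integral_cmult) (measurable, simp only: nn_integral_exp_quadratic[OF M])
  also have "\<dots> = ennreal (?w * ?d)" using c d by (intro ennreal_mult[symmetric]) simp_all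
  also have "?w * ?d = ?d / ?c * exp (\<eta> * (m \<bullet> (W *v m) / 2))" by simp
  finally show "(\<integral>\<^sup>+ y. ennreal (gauss_density m \<Sigma> y) * ennreal (exp (\<eta> * (y \<bullet> (P *v y) / 2))) \<partial>lborel)
       = ennreal (?d / ?c * exp (\<eta> * (m \<bullet> (W *v m) / 2)))" .
qed

context
  fixes Q A :: "real^'n^'n" and B :: "real^'m^'n" and R K :: "real^'m^'m" and G P' :: "real^'n^'n"
  assumes Q: "pos_def Q" and R: "pos_def R"
    and K_def: "K = R + transpose B ** W ** B"
    and G_def: "G = N + B ** matrix_inv R ** transpose B ** P"
    and G_inv: "invertible G"
    and P'_def: "P' = Q + transpose A ** P ** matrix_inv G ** A"
begin

lemma control_precision_mult: "K *v u = R *v u + transpose B *v (W *v (B *v u))"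
  by (simp add: K_def matrix_vector_mult_add_rdistrib matrix_vector_mul_assoc matrix_mul_assoc)

lemma control_precision_pos_def: "pos_def K"
  unfolding pos_def_def
proof (intro conjI allI impI)
  show "transpose K = K"
    using R by (simp add: K_def transpose_add matrix_transpose_mul tilt_symmetric pos_def_def matrix_mul_assoc)
  fix u :: "real^'m"
  assume "u \<noteq> 0"
  have "u \<bullet> (K *v u) = u \<bullet> (R *v u) + (B *v u) \<bullet> (W *v (B *v u))"
    by (simp add: control_precision_mult inner_add_right inner_vector_matrix)
  moreover have "u \<bullet> (R *v u) > 0" using R \<open>u \<noteq> 0\<close> by (simp add: pos_def_def)
  ultimately show "u \<bullet> (K *v u) > 0" using tilt_nonneg[of "B *v u"] by linarith
qed

text \<open>\<open>- k x\<close> is the minimising control. Minimisation over \<open>u\<close>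
  leaves the Schur complement of \<open>K\<close>, namely W - W B K^{-1} B^T W, as a form in A x;
  the point is that this form agrees with P G^{-1}, as the Riccati update demands.\<close>

lemma bellman_complete_square:
  defines "k \<equiv> \<lambda>x. matrix_inv K *v (transpose B *v (W *v (A *v x)))"
  shows "x \<bullet> (Q *v x) + u \<bullet> (R *v u) + (A *v x + B *v u) \<bullet> (W *v (A *v x + B *v u))
       = x \<bullet> (P' *v x) + (u + k x) \<bullet> (K *v (u + k x))"
proof -
  define z where "z = A *v x"
  define y where "y = matrix_inv G *v z"
  have Kt: "transpose K = K" using control_precision_pos_def by (simp add: pos_def_def)
  have Kk: "K *v k x = transpose B *v (W *v z)"
    by (simp add: k_def z_def matrix_inv_cancel pos_def_invertible[OF control_precision_pos_def])
  \<comment> \<open>The gain written through \<open>G\<close> instead of \<open>K\<close>. By the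
    definition of \<open>G\<close>, the equation G y = z splits as z = N y + B k', and
    \<open>W\<close> cancels the factor \<open>N\<close>.\<close>
  define k' where "k' = matrix_inv R *v (transpose B *v (P *v y))"
  have "z = G *v y" by (simp add: y_def matrix_inv_cancel G_inv)
  then have z: "z = N *v y + B *v k'"
    by (simp add: G_def k'_def matrix_vector_mult_add_rdistrib matrix_vector_mul_assoc matrix_mul_assoc)
  have WN: "W *v (N *v y) = P *v y"
    by (simp add: W_def matrix_vector_mul_assoc[symmetric] matrix_inv_cancel tilt_invertible)
  have Wz: "W *v z = P *v y + W *v (B *v k')"
    by (subst z) (simp add: matrix_vector_right_distrib WN)
  \<comment> \<open>The Woodbury identity, applied to the vector \<open>z\<close>.\<close>
  have "K *v k' = transpose B *v (W *v z)"
    by (simp add: control_precision_mult Wz matrix_vector_right_distrib)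
       (simp add: k'_def matrix_inv_cancel pos_def_invertible[OF R])
  then have k: "k x = k'"
    using Kk matrix_inv_cancel(2)[OF pos_def_invertible[OF control_precision_pos_def]] by metis
  have "z \<bullet> (P *v y) = z \<bullet> (W *v z) - z \<bullet> (W *v (B *v k'))"
    using arg_cong[OF Wz, of "\<lambda>w. z \<bullet> w"] by (simp add: inner_add_right)
  also have "z \<bullet> (W *v (B *v k')) = (transpose B *v (W *v z)) \<bullet> k'"
    using tilt_symmetric by (metis inner_matrix_transpose)
  finally have zPy: "z \<bullet> (P *v y) = z \<bullet> (W *v z) - k x \<bullet> (K *v k x)"
    by (simp add: k[symmetric] Kk inner_commute)
  have P'x: "x \<bullet> (P' *v x) = x \<bullet> (Q *v x) + z \<bullet> (P *v y)"
  proof -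
    have "P' *v x = Q *v x + transpose A *v (P *v y)"
      by (simp add: P'_def y_def z_def matrix_vector_mult_add_rdistrib matrix_vector_mul_assoc matrix_mul_assoc)
    then show ?thesis by (simp add: z_def inner_add_right inner_vector_matrix)
  qed
  have "u \<bullet> (K *v u) = u \<bullet> (R *v u) + (B *v u) \<bullet> (W *v (B *v u))"
    by (simp add: control_precision_mult inner_add_right inner_vector_matrix)
  moreover have "u \<bullet> (K *v k x) = z \<bullet> (W *v (B *v u))"
    unfolding Kk using tilt_symmetric by (metis inner_matrix_transpose inner_commute transpose_transpose)
  ultimately show ?thesis
    unfolding P'x zPy z_def[symmetric] quadratic_form_add[OF Kt] quadratic_form_add[OF tilt_symmetric]
    by simp
qed

text \<open>Positivity comes from evaluating the completed square at the minimiser u = - k x, where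
  only the form of \<open>P'\<close> survives on one side and the stage costs plus a nonnegative
  \<open>W\<close> term stand on the other.\<close>

lemma riccati_pos_def: "pos_def P'"
  unfolding pos_def_def
proof (intro conjI allI impI)
  have Pt: "transpose P = P" and Rt: "transpose (matrix_inv R) = matrix_inv R" and St: "transpose \<Sigma> = \<Sigma>"
    using P pos_def_matrix_inv[OF R] Sigma by (auto simp: pos_def_def)
  have "transpose (P ** matrix_inv G) = P ** matrix_inv G"
  proof (rule transpose_mult_matrix_inv[OF Pt G_inv])
    show "transpose G ** P = P ** G"
      by (simp add: G_def N_def transpose_add transpose_diff transpose_scaleR transpose_mat
          matrix_transpose_mul Pt Rt St matrix_mul_diff_left matrix_mul_diff_right matrix_mul_scaleR_left
          matrix_mul_scaleR_right matrix_mul_add_left matrix_mul_add_right matrix_mul_assoc)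
  qed
  then have "transpose (transpose A ** (P ** matrix_inv G) ** A) = transpose A ** (P ** matrix_inv G) ** A"
    by (simp only: matrix_transpose_mul transpose_transpose matrix_mul_assoc)
  moreover have "transpose Q = Q" using Q by (simp add: pos_def_def)
  ultimately show "transpose P' = P'" by (simp add: P'_def transpose_add matrix_mul_assoc)
  fix x :: "real^'n"
  assume "x \<noteq> 0"
  let ?k = "matrix_inv K *v (transpose B *v (W *v (A *v x)))"
  have "x \<bullet> (P' *v x) = x \<bullet> (Q *v x) + (- ?k) \<bullet> (R *v (- ?k))
      + (A *v x + B *v (- ?k)) \<bullet> (W *v (A *v x + B *v (- ?k)))"
    unfolding bellman_complete_square by simp
  moreover have "x \<bullet> (Q *v x) > 0" using Q \<open>x \<noteq> 0\<close> by (simp add: pos_def_def)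
  ultimately show "x \<bullet> (P' *v x) > 0"
    using tilt_nonneg[of "A *v x + B *v (- ?k)"] pos_def_nonneg[OF R, of "- ?k"] by linarith
qed

text \<open>The optimal policy is Gaussian with precision \<open>K\<close>, so the square left over
  in the control is its logarithm up to the normalisation \<open>d\<close>: exp (eta q / 2) is the
  power -eta of exp (- q / 2) = d g. The constant is D kappa d^{-eta}, where \<open>D\<close>
  carries the constants of the later stages.\<close>

lemma bellman_integrand:
  assumes D: "D > 0"
  defines "g \<equiv> \<lambda>x u. gauss_density (- (matrix_inv K *v (transpose B *v (W *v (A *v x))))) (matrix_inv K) u"
  shows "\<exists>c>0. \<forall>x u. ennreal (exp (\<eta> * stage_cost Q R x u))
      * (\<integral>\<^sup>+ y. ennreal (gauss_density (A *v x + B *v u) \<Sigma> y)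
            * ennreal (D * exp (\<eta> * (y \<bullet> (P *v y) / 2))) \<partial>lborel)
      = ennreal (c * exp (\<eta> * (x \<bullet> (P' *v x) / 2)) * g x u powr (- \<eta>))"
proof -
  obtain \<kappa> where kp: "\<kappa> > 0" and k: "\<And>m. (\<integral>\<^sup>+ y. ennreal (gauss_density m \<Sigma> y)
        * ennreal (exp (\<eta> * (y \<bullet> (P *v y) / 2))) \<partial>lborel) = ennreal (\<kappa> * exp (\<eta> * (m \<bullet> (W *v m) / 2)))"
    using nn_integral_gauss_tilt by blast
  define d where "d = sqrt ((2 * pi) ^ CARD('m) * det (matrix_inv K))"
  note Kpd = control_precision_pos_def
  have d: "d > 0" using pos_def_det_pos[OF pos_def_matrix_inv[OF Kpd]] by (simp add: d_def)
  have KK: "matrix_inv (matrix_inv K) = K"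
    by (intro matrix_inv_eqI matrix_inv_left pos_def_invertible Kpd)
  show ?thesis
  proof (intro exI conjI allI)
    let ?c = "D * \<kappa> * d powr (- \<eta>)"
    show "?c > 0" using D kp d by simp
    fix x u
    let ?m = "A *v x + B *v u"
    let ?k = "matrix_inv K *v (transpose B *v (W *v (A *v x)))"
    have "(\<integral>\<^sup>+ y. ennreal (gauss_density ?m \<Sigma> y) * ennreal (D * exp (\<eta> * (y \<bullet> (P *v y) / 2))) \<partial>lborel)
        = (\<integral>\<^sup>+ y. ennreal D * (ennreal (gauss_density ?m \<Sigma> y) * ennreal (exp (\<eta> * (y \<bullet> (P *v y) / 2)))) \<partial>lborel)"
      using D by (intro nn_integral_cong) (simp add: ennreal_mult ac_simps)
    also have "\<dots> = ennreal D * ennreal (\<kappa> * exp (\<eta> * (?m \<bullet> (W *v ?m) / 2)))"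
      unfolding k[symmetric] by (rule nn_integral_cmult) (simp add: gauss_density_def[abs_def])
    finally have 1: "(\<integral>\<^sup>+ y. ennreal (gauss_density ?m \<Sigma> y) * ennreal (D * exp (\<eta> * (y \<bullet> (P *v y) / 2))) \<partial>lborel)
        = ennreal (D * \<kappa> * exp (\<eta> * (?m \<bullet> (W *v ?m) / 2)))"
      using D kp by (simp add: ennreal_mult[symmetric] mult.assoc)
    let ?q = "(u + ?k) \<bullet> (K *v (u + ?k))"
    have "exp (\<eta> * stage_cost Q R x u) * exp (\<eta> * (?m \<bullet> (W *v ?m) / 2))
        = exp (\<eta> * ((x \<bullet> (Q *v x) + u \<bullet> (R *v u) + ?m \<bullet> (W *v ?m)) / 2))"
      by (simp add: exp_add[symmetric] stage_cost_def field_simps)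
    also have "\<dots> = exp (\<eta> * (x \<bullet> (P' *v x) / 2)) * exp (\<eta> * (?q / 2))"
      unfolding bellman_complete_square by (simp add: exp_add[symmetric] field_simps)
    also have "exp (\<eta> * (?q / 2)) = (d * g x u) powr (- \<eta>)"
    proof -
      have "d * g x u = exp (- ?q / 2)"
        using d unfolding g_def gauss_density_def KK d_def[symmetric] by simp
      then show ?thesis by (simp add: powr_def)
    qed
    also have "\<dots> = d powr (- \<eta>) * g x u powr (- \<eta>)"
      using d by (intro powr_mult)
    finally have 2: "exp (\<eta> * stage_cost Q R x u) * exp (\<eta> * (?m \<bullet> (W *v ?m) / 2))
        = exp (\<eta> * (x \<bullet> (P' *v x) / 2)) * (d powr (- \<eta>) * g x u powr (- \<eta>))" .
    have "ennreal (exp (\<eta> * stage_cost Q R x u)) * ennreal (D * \<kappa> * exp (\<eta> * (?m \<bullet> (W *v ?m) / 2)))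
        = ennreal (D * \<kappa> * (exp (\<eta> * stage_cost Q R x u) * exp (\<eta> * (?m \<bullet> (W *v ?m) / 2))))"
      using D kp by (simp add: ennreal_mult[symmetric] ac_simps)
    then show "ennreal (exp (\<eta> * stage_cost Q R x u))
      * (\<integral>\<^sup>+ y. ennreal (gauss_density ?m \<Sigma> y) * ennreal (D * exp (\<eta> * (y \<bullet> (P *v y) / 2))) \<partial>lborel)
      = ennreal (?c * exp (\<eta> * (x \<bullet> (P' *v x) / 2)) * g x u powr (- \<eta>))"
      unfolding 1 2 by (simp only: ac_simps)
  qed
qed

end

end

section \<open>Power divergence of densities\<close>

lemma exp_gt_add_one:
  fixes x :: real
  assumes "x \<noteq> 0"
  shows "1 + x < exp x"
proof (rule ccontr)
  assume "\<not> 1 + x < exp x"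
  then have "exp x = 1 + x" using exp_ge_add_one_self[of x] by linarith
  then have "ln (exp x) = exp x - 1" by (subst ln_exp) simp
  then have "exp x = 1" by (intro ln_eq_minus_one) simp_all
  with assms show False by simp
qed

lemma powr_tangent_strict_lt:
  fixes s a :: real
  assumes s: "0 \<le> s" "s \<noteq> 1" and a: "0 < a" "a < 1"
  shows "s powr a < a * s + (1 - a)"
proof (cases "s = 0")
  case True
  with a show ?thesis by simp
next
  case False
  with s have s0: "s > 0" by simp
  define L where "L = ln s"
  have L: "L \<noteq> 0" using s s0 by (simp add: L_def)
  \<comment> \<open>Tangents of the exponential at \<open>a * L\<close>, evaluated at \<open>L\<close> and \<open>0\<close>.\<close>
  have "exp (a * L) * (1 + (1 - a) * L) < exp (a * L) * exp ((1 - a) * L)"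
    using L a by (intro mult_strict_left_mono exp_gt_add_one) auto
  moreover have "exp (a * L) * exp ((1 - a) * L) = s"
    using s0 by (simp add: L_def exp_add[symmetric] algebra_simps)
  ultimately have 1: "a * (exp (a * L) * (1 + (1 - a) * L)) < a * s"
    using a by simp
  have "exp (a * L) * (1 + (- a * L)) < exp (a * L) * exp (- a * L)"
    using L a by (intro mult_strict_left_mono exp_gt_add_one) auto
  moreover have "exp (a * L) * exp (- a * L) = 1"
    by (simp add: exp_add[symmetric])
  ultimately have "exp (a * L) * (1 + (- a * L)) < 1" by (simp only:)
  then have 2: "(1 - a) * (exp (a * L) * (1 + (- a * L))) < (1 - a) * 1"
    using a by (intro mult_strict_left_mono) simp_all
  have "s powr a = exp (a * L)" using s0 by (simp add: L_def powr_def)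
  also have "\<dots> = a * (exp (a * L) * (1 + (1 - a) * L)) + (1 - a) * (exp (a * L) * (1 + (- a * L)))"
    by (simp add: algebra_simps)
  also have "\<dots> < a * s + (1 - a) * 1" by (rule add_strict_mono[OF 1 2])
  finally show ?thesis by simp
qed

text \<open>The concave case applied to \<open>s powr a\<close> with exponent \<open>1 / a\<close>,
  then multiplied by \<open>a\<close>.\<close>

lemma powr_tangent_strict_gt:
  fixes s a :: real
  assumes s: "0 \<le> s" "s \<noteq> 1" and a: "1 < a"
  shows "a * s + (1 - a) < s powr a"
proof -
  have ps: "(s powr a) powr (1 / a) = s" using s a by (simp add: powr_powr)
  have "s powr a \<noteq> 1" using ps s by auto
  then have "(s powr a) powr (1 / a) < 1 / a * (s powr a) + (1 - 1 / a)"
    using s a by (intro powr_tangent_strict_lt) auto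
  then have "a * s < a * (1 / a * (s powr a) + (1 - 1 / a))" using a by (simp add: ps)
  also have "\<dots> = s powr a + a - 1" using a by (simp add: field_simps)
  finally show ?thesis by simp
qed

text \<open>The nonnegative difference has integral 0. Finiteness of the smaller integral is what
  permits the subtraction.\<close>

lemma nn_integral_eq_imp_AE_eq:
  assumes [measurable]: "f \<in> borel_measurable M" "g \<in> borel_measurable M"
    and le: "AE x in M. f x \<le> g x" and eq: "integral\<^sup>N M g \<le> integral\<^sup>N M f" and fin: "integral\<^sup>N M f \<noteq> \<infinity>"
  shows "AE x in M. f x = g x"
proof -
  have "(\<integral>\<^sup>+ x. g x - f x \<partial>M) = integral\<^sup>N M g - integral\<^sup>N M f"
    using fin le by (intro nn_integral_diff) auto
  also have "\<dots> = 0" using eq fin by (simp add: diff_eq_0_iff_ennreal top.not_eq_extremum)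
  finally have "AE x in M. g x - f x = 0"
    by (subst (asm) nn_integral_0_iff_AE) auto
  moreover have "AE x in M. f x \<noteq> \<infinity>"
    using fin by (intro nn_integral_PInf_AE) auto
  ultimately show ?thesis using le
    by eventually_elim (auto simp: diff_eq_0_iff_ennreal)
qed

text \<open>The order in which a smaller exponential cost means a smaller objective: \<open>eta_log \<eta>\<close> is increasing
  for \<open>\<eta> > 0\<close> and decreasing for \<open>\<eta> < 0\<close>.\<close>

definition eta_le :: "real \<Rightarrow> ennreal \<Rightarrow> ennreal \<Rightarrow> bool" where
  "eta_le \<eta> a b \<longleftrightarrow> (if \<eta> > 0 then a \<le> b else b \<le> a)"

lemma eta_le_refl [simp]: "eta_le \<eta> a a"
  by (simp add: eta_le_def)

lemma eta_le_trans: "eta_le \<eta> a b \<Longrightarrow> eta_le \<eta> b c \<Longrightarrow> eta_le \<eta> a c"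
  by (auto simp: eta_le_def split: if_splits)

lemma eta_le_antisym: "eta_le \<eta> a b \<Longrightarrow> eta_le \<eta> b a \<Longrightarrow> a = b"
  by (auto simp: eta_le_def split: if_splits)

lemma eta_le_mult_left: "eta_le \<eta> a b \<Longrightarrow> eta_le \<eta> (c * a) (c * b)"
  by (auto simp: eta_le_def mult_left_mono split: if_splits)

lemma eta_le_nn_integral:
  "(\<And>x. eta_le \<eta> (f x) (g x)) \<Longrightarrow> eta_le \<eta> (integral\<^sup>N M f) (integral\<^sup>N M g)"
  by (auto simp: eta_le_def intro!: nn_integral_mono split: if_splits)

lemma eta_le_nn_integral_AE_eq:
  assumes [measurable]: "f \<in> borel_measurable M" "g \<in> borel_measurable M"
    and le: "\<And>x. eta_le \<eta> (f x) (g x)" and eq: "integral\<^sup>N M f = integral\<^sup>N M g"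
    and fin: "integral\<^sup>N M f \<noteq> \<infinity>"
  shows "AE x in M. f x = g x"
proof (cases "\<eta> > 0")
  case True
  then show ?thesis using le eq fin by (intro nn_integral_eq_imp_AE_eq) (auto simp: eta_le_def)
next
  case False
  then have "AE x in M. g x = f x"
    using le eq fin by (intro nn_integral_eq_imp_AE_eq) (auto simp: eta_le_def)
  then show ?thesis by (auto simp: eq_commute)
qed

text \<open>The integral is a power divergence of \<open>p\<close> from \<open>g\<close>. The
  tangent line at 1, evaluated at p / g and multiplied by g, integrates to 1; it is strict wherever
  p and g differ, which settles the equality case.\<close>

lemma density_power_divergence:
  fixes p g :: "'a \<Rightarrow> real"
  assumes eta: "\<eta> > -1" "\<eta> \<noteq> 0"
    and meas [measurable]: "p \<in> borel_measurable M" "g \<in> borel_measurable M"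
    and p: "\<And>u. 0 \<le> p u" "(\<integral>\<^sup>+ u. p u \<partial>M) = 1"
    and g: "\<And>u. 0 < g u" "(\<integral>\<^sup>+ u. g u \<partial>M) = 1"
  defines "h \<equiv> \<lambda>u. p u * exp (\<eta> * ln (p u)) * g u powr (- \<eta>)"
  shows "eta_le \<eta> 1 (\<integral>\<^sup>+ u. h u \<partial>M)"
    and "(\<integral>\<^sup>+ u. h u \<partial>M) = 1 \<Longrightarrow> AE u in M. p u = g u"
proof -
  have [measurable]: "h \<in> borel_measurable M" unfolding h_def by measurable
  have h_eq: "h u = (p u / g u) powr (1 + \<eta>) * g u" for u
  proof (cases "p u = 0")
    \<comment> \<open>Where \<open>p u\<close> vanishes both sides are 0, whatever value
      \<open>ln 0\<close> has, because \<open>0 powr a = 0\<close>.\<close>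
    case True
    then show ?thesis by (simp add: h_def)
  next
    case False
    with p have pu: "p u > 0" by (simp add: less_le)
    have "p u * exp (\<eta> * ln (p u)) = p u powr (1 + \<eta>)"
      using pu by (simp add: powr_add) (simp add: powr_def)
    moreover have "g u powr (- \<eta>) = g u / g u powr (1 + \<eta>)"
      using g(1)[of u] by (simp add: powr_minus powr_add field_simps)
    ultimately show ?thesis
      using pu g(1)[of u] by (simp add: h_def powr_divide)
  qed
  have hnn: "0 \<le> h u" for u using p(1)[of u] by (simp add: h_def)
  have lin: "((1 + \<eta>) * (p u / g u) + (1 - (1 + \<eta>))) * g u = (1 + \<eta>) * p u - \<eta> * g u" for u
    using g(1)[of u] by (simp add: field_simps)
  have *: "eta_le \<eta> 1 (\<integral>\<^sup>+ u. h u \<partial>M) \<and> ((\<integral>\<^sup>+ u. h u \<partial>M) = 1 \<longrightarrow> (AE u in M. p u = g u))"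
  proof (cases "\<eta> > 0")
    case True
    \<comment> \<open>The term eta g is moved to the side of \<open>h\<close>, so that both sides
      are nonnegative and integrate termwise in \<open>ennreal\<close>.\<close>
    have strict: "(1 + \<eta>) * p u < h u + \<eta> * g u" if "p u \<noteq> g u" for u
    proof -
      have "((1 + \<eta>) * (p u / g u) + (1 - (1 + \<eta>))) * g u < h u"
        unfolding h_eq using that p(1)[of u] g(1)[of u] True
        by (intro mult_strict_right_mono powr_tangent_strict_gt) auto
      then show ?thesis unfolding lin by simp
    qed
    have eq: "(1 + \<eta>) * p u = h u + \<eta> * g u" if "p u = g u" for u
      using that g(1)[of u] by (simp add: h_eq algebra_simps)
    have le: "(1 + \<eta>) * p u \<le> h u + \<eta> * g u" for u
      using strict[of u] eq[of u] by (cases "p u = g u") auto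
    have Ip: "(\<integral>\<^sup>+ u. ennreal ((1 + \<eta>) * p u) \<partial>M) = ennreal (1 + \<eta>)"
      using True p by (simp add: ennreal_mult nn_integral_cmult)
    have Ih: "(\<integral>\<^sup>+ u. ennreal (h u + \<eta> * g u) \<partial>M) = (\<integral>\<^sup>+ u. h u \<partial>M) + ennreal \<eta>"
      using True hnn g(1) g(2) by (simp add: ennreal_plus ennreal_mult less_imp_le nn_integral_add nn_integral_cmult)
    have "ennreal (1 + \<eta>) \<le> (\<integral>\<^sup>+ u. h u \<partial>M) + ennreal \<eta>"
      unfolding Ip[symmetric] Ih[symmetric] using le by (intro nn_integral_mono ennreal_leI) auto
    then have "1 \<le> (\<integral>\<^sup>+ u. h u \<partial>M)"
      using True by (simp add: ennreal_plus add.commute ennreal_add_left_cancel_le)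
    moreover have "AE u in M. p u = g u" if h1: "(\<integral>\<^sup>+ u. h u \<partial>M) = 1"
    proof -
      have "AE u in M. ennreal ((1 + \<eta>) * p u) = ennreal (h u + \<eta> * g u)"
        using True le
        by (intro nn_integral_eq_imp_AE_eq) (auto simp: Ip Ih h1 ennreal_leI ennreal_plus)
      then show ?thesis
      proof eventually_elim
        case (elim u)
        have "0 \<le> (1 + \<eta>) * p u" "0 \<le> h u + \<eta> * g u"
          using True p(1)[of u] g(1)[of u] hnn[of u] by auto
        with elim have "(1 + \<eta>) * p u = h u + \<eta> * g u" by simp
        with strict[of u] show ?case by (cases "p u = g u") auto
      qed
    qed
    ultimately show ?thesis using True by (auto simp: eta_le_def)
  next
    case False
    with eta have n: "\<eta> < 0" by simp
    \<comment> \<open>For negative eta the coefficient -eta is positive, so the \<open>g\<close>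
      term stays beside \<open>p\<close> and the two weights 1 + eta and -eta sum to 1.\<close>
    have strict: "h u < (1 + \<eta>) * p u + (- \<eta>) * g u" if "p u \<noteq> g u" for u
    proof -
      have "h u < ((1 + \<eta>) * (p u / g u) + (1 - (1 + \<eta>))) * g u"
        unfolding h_eq using that p(1)[of u] g(1)[of u] n eta
        by (intro mult_strict_right_mono powr_tangent_strict_lt) auto
      then show ?thesis unfolding lin by simp
    qed
    have eq: "h u = (1 + \<eta>) * p u + (- \<eta>) * g u" if "p u = g u" for u
      using that g(1)[of u] by (simp add: h_eq algebra_simps)
    have le: "h u \<le> (1 + \<eta>) * p u + (- \<eta>) * g u" for u
      using strict[of u] eq[of u] by (cases "p u = g u") auto
    have "(\<integral>\<^sup>+ u. ennreal ((1 + \<eta>) * p u + (- \<eta>) * g u) \<partial>M)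
        = (\<integral>\<^sup>+ u. ennreal (1 + \<eta>) * ennreal (p u) + ennreal (- \<eta>) * ennreal (g u) \<partial>M)"
    proof (intro nn_integral_cong)
      fix u
      show "ennreal ((1 + \<eta>) * p u + (- \<eta>) * g u) = ennreal (1 + \<eta>) * ennreal (p u) + ennreal (- \<eta>) * ennreal (g u)"
        using n eta p(1)[of u] g(1)[of u] 
        by (simp add: ennreal_plus[symmetric] ennreal_mult[symmetric] mult_nonpos_nonneg del: ennreal_plus)
    qed
    also have "\<dots> = ennreal (1 + \<eta>) + ennreal (- \<eta>)"
      using p g by (simp add: nn_integral_add nn_integral_cmult)
    also have "\<dots> = 1" using n eta by (simp add: ennreal_plus[symmetric] del: ennreal_plus)
    finally have Ip: "(\<integral>\<^sup>+ u. ennreal ((1 + \<eta>) * p u + (- \<eta>) * g u) \<partial>M) = 1" .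
    have "(\<integral>\<^sup>+ u. h u \<partial>M) \<le> 1"
      unfolding Ip[symmetric] using le by (intro nn_integral_mono ennreal_leI) auto
    moreover have "AE u in M. p u = g u" if h1: "(\<integral>\<^sup>+ u. h u \<partial>M) = 1"
    proof -
      have "AE u in M. ennreal (h u) = ennreal ((1 + \<eta>) * p u + (- \<eta>) * g u)"
        using le by (intro nn_integral_eq_imp_AE_eq) (auto simp only: Ip h1 ennreal_leI, auto)
      then show ?thesis
      proof eventually_elim
        case (elim u)
        have "0 \<le> (1 + \<eta>) * p u + (- \<eta>) * g u"
          using hnn[of u] le[of u] by linarith
        with elim hnn[of u] have "h u = (1 + \<eta>) * p u + (- \<eta>) * g u" by (simp add: ennreal_inj)
        with strict[of u] show ?case by (cases "p u = g u") auto
      qed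
    qed
    ultimately show ?thesis using False by (auto simp: eta_le_def)
  qed
  show "eta_le \<eta> 1 (\<integral>\<^sup>+ u. h u \<partial>M)" using * by simp
  show "(\<integral>\<^sup>+ u. h u \<partial>M) = 1 \<Longrightarrow> AE u in M. p u = g u" using * by simp
qed

section \<open>Dynamic programming\<close>

lemma eta_log_mono:
  assumes "\<eta> \<noteq> 0" "eta_le \<eta> a b"
  shows "eta_log \<eta> a \<le> eta_log \<eta> b"
proof (cases "\<eta> > 0")
  case True
  show ?thesis
  proof (cases "b = \<infinity> \<or> a = 0")
    case True
    then show ?thesis using \<open>\<eta> > 0\<close> by (auto simp: eta_log_def)
  next
    case False
    have "a \<le> b" using \<open>\<eta> > 0\<close> assms by (simp add: eta_le_def)
    with False have "a \<noteq> \<infinity>" "b \<noteq> 0" by (auto simp: top_unique)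
    moreover have "0 < enn2real a" using False \<open>a \<noteq> \<infinity>\<close>
      by (simp add: enn2real_positive_iff less_top[symmetric] zero_less_iff_neq_zero)
    moreover have "enn2real a \<le> enn2real b"
      using \<open>a \<le> b\<close> False by (intro enn2real_mono) (auto simp: less_top[symmetric])
    ultimately show ?thesis using False \<open>\<eta> > 0\<close>
      by (auto simp: eta_log_def intro!: divide_right_mono)
  qed
next
  case False
  then have n: "\<eta> < 0" using assms by simp
  show ?thesis
  proof (cases "b = 0 \<or> a = \<infinity>")
    case True
    then show ?thesis using n by (auto simp: eta_log_def)
  next
    case False
    have "b \<le> a" using n assms by (simp add: eta_le_def)
    with False have "b \<noteq> \<infinity>" "a \<noteq> 0" by (auto simp: top_unique)
    moreover have "0 < enn2real b" using False \<open>b \<noteq> \<infinity>\<close>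
      by (simp add: enn2real_positive_iff less_top[symmetric] zero_less_iff_neq_zero)
    moreover have "enn2real b \<le> enn2real a"
      using \<open>b \<le> a\<close> False by (intro enn2real_mono) (auto simp: less_top[symmetric])
    ultimately show ?thesis using False n
      by (auto simp: eta_log_def intro!: divide_right_mono_neg)
  qed
qed

text \<open>A finite objective excludes the exponential costs 0 and infinity, and between them the
  logarithm is injective. The finiteness of \<open>a\<close> is recorded because the equality case
  of integral comparison requires it.\<close>

lemma eta_log_inj:
  assumes eta: "\<eta> \<noteq> 0" and eq: "eta_log \<eta> a = eta_log \<eta> b" and fin: "\<bar>eta_log \<eta> a\<bar> \<noteq> \<infinity>"
  shows "a = b \<and> a \<noteq> \<infinity>"
proof -
  have a: "a \<noteq> \<infinity>" "a \<noteq> 0" using fin by (auto simp: eta_log_def split: if_splits)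
  have b: "b \<noteq> \<infinity>" "b \<noteq> 0" using fin eq by (auto simp: eta_log_def split: if_splits)
  have pos: "0 < enn2real a" "0 < enn2real b"
    using a b by (simp_all add: enn2real_positive_iff less_top[symmetric] zero_less_iff_neq_zero)
  have "ln (enn2real a) = ln (enn2real b)" using eq a b eta by (simp add: eta_log_def)
  then have "enn2real a = enn2real b" using pos by simp
  then have "a = b" using a b by (metis ennreal_enn2real infinity_ennreal_def less_top)
  with a show ?thesis by simp
qed

lemma borel_measurable_gauss_density [measurable (raw)]:
  fixes S :: "real^'n^'n"
  assumes [measurable]: "f \<in> borel_measurable M" "h \<in> borel_measurable M"
  shows "(\<lambda>x. gauss_density (f x) S (h x)) \<in> borel_measurable M"
  unfolding gauss_density_def by measurable

lemma borel_measurable_stage_cost [measurable (raw)]: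
  assumes [measurable]: "f \<in> borel_measurable M" "h \<in> borel_measurable M"
  shows "(\<lambda>x. stage_cost Q R (f x) (h x)) \<in> borel_measurable M"
  unfolding stage_cost_def by measurable

lemma admissible_policyD:
  assumes "admissible_policy T pol" "t < T"
  shows "case_prod (pol t) \<in> borel_measurable (borel \<Otimes>\<^sub>M borel)"
    and "pol t x \<in> borel_measurable borel"
    and "0 \<le> pol t x u"
    and "(\<integral>\<^sup>+ u. ennreal (pol t x u) \<partial>lborel) = 1"
proof -
  show 1: "case_prod (pol t) \<in> borel_measurable (borel \<Otimes>\<^sub>M borel)"
    using assms by (simp add: admissible_policy_def borel_prod)
  show "pol t x \<in> borel_measurable borel"
    using measurable_compose[OF measurable_Pair1'[of x borel borel] 1] by simp
  show "0 \<le> pol t x u" "(\<integral>\<^sup>+ u. ennreal (pol t x u) \<partial>lborel) = 1"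
    using assms by (simp_all add: admissible_policy_def)
qed

lemma borel_measurable_exp_cost_to_go:
  assumes adm: "admissible_policy T pol" and "k \<le> T"
  shows "exp_cost_to_go T \<eta> A B \<Sigma> Q R pol k \<in> borel_measurable borel"
  using \<open>k \<le> T\<close>
proof (induction k)
  case 0
  show ?case by (simp add: term_cost_def)
next
  case (Suc k)
  let ?t = "T - Suc k"
  let ?F = "exp_cost_to_go T \<eta> A B \<Sigma> Q R pol k"
  have [measurable]: "?F \<in> borel_measurable borel" using Suc by simp
  have [measurable]: "case_prod (pol ?t) \<in> borel_measurable (borel \<Otimes>\<^sub>M borel)"
    using Suc by (intro admissible_policyD[OF adm]) simp
  have [measurable]: "(\<lambda>z. \<integral>\<^sup>+ y. ennreal (gauss_density (A ?t *v fst z + B ?t *v snd z) (\<Sigma> ?t) y) * ?F y \<partial>lborel)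
      \<in> borel_measurable (borel \<Otimes>\<^sub>M borel)"
    by (intro lborel.borel_measurable_nn_integral) measurable
  have "(\<lambda>(x, u). ennreal (pol ?t x u) * ennreal (exp (\<eta> * (stage_cost (Q ?t) (R ?t) x u + ln (pol ?t x u))))
        * (\<integral>\<^sup>+ y. ennreal (gauss_density (A ?t *v x + B ?t *v u) (\<Sigma> ?t) y) * ?F y \<partial>lborel))
      = (\<lambda>z. ennreal (case_prod (pol ?t) z) * ennreal (exp (\<eta> * (stage_cost (Q ?t) (R ?t) (fst z) (snd z) + ln (case_prod (pol ?t) z))))
        * (\<integral>\<^sup>+ y. ennreal (gauss_density (A ?t *v fst z + B ?t *v snd z) (\<Sigma> ?t) y) * ?F y \<partial>lborel))"
    by (simp add: fun_eq_iff)
  also have "\<dots> \<in> borel_measurable (borel \<Otimes>\<^sub>M borel)" by measurable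
  finally have "(\<lambda>(x, u). ennreal (pol ?t x u) * ennreal (exp (\<eta> * (stage_cost (Q ?t) (R ?t) x u + ln (pol ?t x u))))
        * (\<integral>\<^sup>+ y. ennreal (gauss_density (A ?t *v x + B ?t *v u) (\<Sigma> ?t) y) * ?F y \<partial>lborel))
      \<in> borel_measurable (borel \<Otimes>\<^sub>M lborel)" by (simp cong: measurable_cong_sets)
  then show ?case
    unfolding exp_cost_to_go.simps Let_def by (rule lborel.borel_measurable_nn_integral)
qed

text \<open>Equality almost everywhere is used through a single point at which it holds; the whole
  space is not Lebesgue null.\<close>

lemma AE_lborel_witness:
  assumes "AE x in (lborel :: 'a::euclidean_space measure). \<Phi> x"
  shows "\<exists>x. \<Phi> x"
proof (rule ccontr)
  assume "\<not> ?thesis"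
  with assms have "AE x in (lborel :: 'a measure). False" by simp
  then show False by (simp add: AE_iff_null null_sets_def emeasure_lborel_UNIV)
qed

section \<open>Verification argument for any positive policy \<open>g\<close> and value
  \<open>V\<close> linked by a Bellman identity, with \<open>k\<close> stages left at time
  \<open>T - k\<close>\<close>

context
  fixes T :: nat and \<eta> :: real
    and A :: "nat \<Rightarrow> real^'n^'n" and B :: "nat \<Rightarrow> real^'m^'n"
    and \<Sigma> Q :: "nat \<Rightarrow> real^'n^'n" and R :: "nat \<Rightarrow> real^'m^'m"
    and g :: "nat \<Rightarrow> real^'n \<Rightarrow> real^'m \<Rightarrow> real" and V :: "nat \<Rightarrow> real^'n \<Rightarrow> real"
  assumes eta: "\<eta> > -1" "\<eta> \<noteq> 0"
    and Sigma_pd: "\<And>t. t < T \<Longrightarrow> pos_def (\<Sigma> t)"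
    and g_adm: "admissible_policy T g"
    and g_pos: "\<And>t x u. t < T \<Longrightarrow> 0 < g t x u"
    and V_pos: "\<And>k x. k \<le> T \<Longrightarrow> 0 < V k x"
    and V_0: "\<And>x. V 0 x = exp (\<eta> * term_cost (Q T) x)"
    and bellman: "\<And>k t x u. k < T \<Longrightarrow> t = T - Suc k \<Longrightarrow>
      ennreal (exp (\<eta> * stage_cost (Q t) (R t) x u))
        * (\<integral>\<^sup>+ y. ennreal (gauss_density (A t *v x + B t *v u) (\<Sigma> t) y) * ennreal (V k y) \<partial>lborel)
      = ennreal (V (Suc k) x * g t x u powr (- \<eta>))"
begin

abbreviation cost_to_go where
  "cost_to_go pol k \<equiv> exp_cost_to_go T \<eta> A B \<Sigma> Q R pol k"

lemma bellman_integrand_split: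
  assumes "0 \<le> p"
  shows "ennreal p * ennreal (exp (\<eta> * (c + ln p))) * I
       = ennreal (p * exp (\<eta> * ln p)) * (ennreal (exp (\<eta> * c)) * I)"
  using assms by (simp add: distrib_left exp_add ennreal_mult ac_simps)

text \<open>For the policy \<open>g\<close> itself the factor g^{1 + eta} g^{-eta} reduces to g,
  which integrates to 1 and leaves only \<open>V\<close>.\<close>

lemma cost_to_go_optimal:
  assumes "k \<le> T"
  shows "cost_to_go g k x = ennreal (V k x)"
  using assms
proof (induction k arbitrary: x)
  case 0
  show ?case by (simp add: V_0)
next
  case (Suc k)
  define t where "t = T - Suc k"
  have t: "t < T" and k: "k < T" using Suc by (auto simp: t_def)
  note g = admissible_policyD[OF g_adm t]
  have [measurable]: "g t x \<in> borel_measurable borel" by (rule g)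
  have int: "g t x u * exp (\<eta> * ln (g t x u)) * (V (Suc k) x * g t x u powr (- \<eta>)) = V (Suc k) x * g t x u" for u
    using g_pos[OF t, of x u] by (simp add: powr_def exp_minus)
  have "cost_to_go g (Suc k) x = (\<integral>\<^sup>+ u. ennreal (V (Suc k) x) * ennreal (g t x u) \<partial>lborel)"
    unfolding exp_cost_to_go.simps Let_def t_def[symmetric]
  proof (rule nn_integral_cong)
    fix u
    have "(\<integral>\<^sup>+ y. ennreal (gauss_density (A t *v x + B t *v u) (\<Sigma> t) y) * cost_to_go g k y \<partial>lborel)
        = (\<integral>\<^sup>+ y. ennreal (gauss_density (A t *v x + B t *v u) (\<Sigma> t) y) * ennreal (V k y) \<partial>lborel)"
      using Suc by simp
    then show "ennreal (g t x u) * ennreal (exp (\<eta> * (stage_cost (Q t) (R t) x u + ln (g t x u))))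
        * (\<integral>\<^sup>+ y. ennreal (gauss_density (A t *v x + B t *v u) (\<Sigma> t) y) * cost_to_go g k y \<partial>lborel)
        = ennreal (V (Suc k) x) * ennreal (g t x u)"
      using g_pos[OF t, of x u] V_pos[OF \<open>Suc k \<le> T\<close>, of x]
      by (simp only: bellman_integrand_split less_imp_le bellman[OF k t_def])
         (simp add: ennreal_mult[symmetric] int)
  qed
  also have "\<dots> = ennreal (V (Suc k) x)" by (simp add: nn_integral_cmult g)
  finally show ?case .
qed

text \<open>Two comparisons are chained: first the later cost is replaced by \<open>V\<close>, then
  the present policy by \<open>g\<close>. Equality of the extremes forces equality in both; the
  divergence then identifies the policy, and the integrals over the next state identify the later
  cost.\<close>

lemma cost_to_go_step:
  assumes adm: "admissible_policy T pol" and k: "k < T"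
    and IH: "\<And>y. eta_le \<eta> (ennreal (V k y)) (cost_to_go pol k y)"
  shows "eta_le \<eta> (ennreal (V (Suc k) x)) (cost_to_go pol (Suc k) x)"
    and "cost_to_go pol (Suc k) x = ennreal (V (Suc k) x) \<Longrightarrow>
      (AE u in lborel. pol (T - Suc k) x u = g (T - Suc k) x u)
      \<and> (AE y in lborel. cost_to_go pol k y = ennreal (V k y))"
proof -
  define t where "t = T - Suc k"
  have t: "t < T" using k by (auto simp: t_def)
  note g = admissible_policyD[OF g_adm t]
  note p = admissible_policyD[OF adm t]
  have [measurable]: "g t x \<in> borel_measurable borel" "pol t x \<in> borel_measurable borel" by (rule g p)+
  let ?F = "cost_to_go pol k"
  have F [measurable]: "?F \<in> borel_measurable borel"
    using k by (intro borel_measurable_exp_cost_to_go[OF adm]) simp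
  have V [measurable]: "(\<lambda>y. ennreal (V k y)) \<in> borel_measurable borel"
    using borel_measurable_exp_cost_to_go[OF g_adm, of k \<eta> A B \<Sigma> Q R] k cost_to_go_optimal[of k]
    by (simp cong: measurable_cong)
  define IF where "IF = (\<lambda>u. \<integral>\<^sup>+ y. ennreal (gauss_density (A t *v x + B t *v u) (\<Sigma> t) y) * ?F y \<partial>lborel)"
  define IV where "IV = (\<lambda>u. \<integral>\<^sup>+ y. ennreal (gauss_density (A t *v x + B t *v u) (\<Sigma> t) y) * ennreal (V k y) \<partial>lborel)"
  have [measurable]: "IF \<in> borel_measurable borel" unfolding IF_def
    by (intro lborel.borel_measurable_nn_integral) measurable
  have [measurable]: "IV \<in> borel_measurable borel" unfolding IV_def
    by (intro lborel.borel_measurable_nn_integral) measurable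
  define a where "a = (\<lambda>u. ennreal (pol t x u * exp (\<eta> * ln (pol t x u))))"
  define e where "e = (\<lambda>u. ennreal (exp (\<eta> * stage_cost (Q t) (R t) x u)))"
  have [measurable]: "a \<in> borel_measurable borel" "e \<in> borel_measurable borel"
    unfolding a_def e_def by measurable
  let ?h = "\<lambda>u. pol t x u * exp (\<eta> * ln (pol t x u)) * g t x u powr (- \<eta>)"
  let ?v = "V (Suc k) x"
  have v: "?v > 0" using V_pos[of "Suc k" x] k by simp
  have step: "cost_to_go pol (Suc k) x = (\<integral>\<^sup>+ u. a u * (e u * IF u) \<partial>lborel)"
    unfolding exp_cost_to_go.simps Let_def t_def[symmetric] a_def e_def IF_def
    by (simp only: bellman_integrand_split p(3))
  have eIV: "e u * IV u = ennreal (?v * g t x u powr (- \<eta>))" for u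
    unfolding e_def IV_def by (rule bellman[OF k t_def])
  have J: "a u * (e u * IV u) = ennreal ?v * ennreal (?h u)" for u
    using v p(3) unfolding eIV a_def by (simp add: ennreal_mult[symmetric] ac_simps)
  have IJ: "(\<integral>\<^sup>+ u. a u * (e u * IV u) \<partial>lborel) = ennreal ?v * (\<integral>\<^sup>+ u. ennreal (?h u) \<partial>lborel)"
    unfolding J by (rule nn_integral_cmult) measurable
  note div = density_power_divergence[OF eta, where M = lborel and p = "pol t x" and g = "g t x"]
  have h1: "eta_le \<eta> 1 (\<integral>\<^sup>+ u. ennreal (?h u) \<partial>lborel)"
    using p g g_pos[OF t] by (intro div) auto
  have h2: "AE u in lborel. pol t x u = g t x u" if "(\<integral>\<^sup>+ u. ennreal (?h u) \<partial>lborel) = 1"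
    using p g g_pos[OF t] that by (intro div) auto
  have le1: "eta_le \<eta> (ennreal ?v) (\<integral>\<^sup>+ u. a u * (e u * IV u) \<partial>lborel)"
    unfolding IJ using eta_le_mult_left[OF h1, of "ennreal ?v"] by simp
  have le_int: "eta_le \<eta> (IV u) (IF u)" for u
    unfolding IV_def IF_def by (intro eta_le_nn_integral eta_le_mult_left IH)
  have le2: "eta_le \<eta> (\<integral>\<^sup>+ u. a u * (e u * IV u) \<partial>lborel) (\<integral>\<^sup>+ u. a u * (e u * IF u) \<partial>lborel)"
    by (intro eta_le_nn_integral eta_le_mult_left le_int)
  show "eta_le \<eta> (ennreal ?v) (cost_to_go pol (Suc k) x)"
    unfolding step using le1 le2 by (rule eta_le_trans)
  assume "cost_to_go pol (Suc k) x = ennreal ?v"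
  then have eqF: "(\<integral>\<^sup>+ u. a u * (e u * IF u) \<partial>lborel) = ennreal ?v" by (simp only: step)
  then have eqV: "(\<integral>\<^sup>+ u. a u * (e u * IV u) \<partial>lborel) = ennreal ?v"
    using le1 le2 eta_le_antisym by metis
  then have "ennreal ?v * (\<integral>\<^sup>+ u. ennreal (?h u) \<partial>lborel) = ennreal ?v * 1" by (simp add: IJ)
  then have "(\<integral>\<^sup>+ u. ennreal (?h u) \<partial>lborel) = 1"
    using v by (subst (asm) ennreal_mult_cancel_left) auto
  then have pg: "AE u in lborel. pol t x u = g t x u" by (rule h2)
  have "AE u in lborel. a u * (e u * IV u) = a u * (e u * IF u)"
    by (rule eta_le_nn_integral_AE_eq[of _ _ _ \<eta>])
       (auto simp: eqF eqV intro: eta_le_mult_left le_int)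
  with pg have "AE u in lborel. pol t x u = g t x u \<and> a u * (e u * IV u) = a u * (e u * IF u)"
    by eventually_elim simp
  \<comment> \<open>One control suffices. At it the policy equals \<open>g\<close>, hence is
    positive, so the factors \<open>a u\<close> and \<open>e u\<close> cancel; and since the
    transition density from it is positive everywhere, equality of the inner integrals reaches
    almost every next state.\<close>
  then obtain u where u: "pol t x u = g t x u" "a u * (e u * IV u) = a u * (e u * IF u)"
    using AE_lborel_witness by blast
  have "a u \<noteq> 0" "a u \<noteq> \<infinity>" "e u \<noteq> 0" "e u \<noteq> \<infinity>"
    using g_pos[OF t, of x u] by (auto simp: a_def e_def u(1))
  then have eqI: "IV u = IF u" using u(2) by (simp add: ennreal_mult_cancel_left)
  \<comment> \<open>Finiteness comes from the Bellman identity: the product of \<open>e u\<close>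
    and \<open>IV u\<close> is a real number.\<close>
  have finI: "IV u \<noteq> \<infinity>"
  proof
    assume "IV u = \<infinity>"
    with eIV[of u] \<open>e u \<noteq> 0\<close> show False by (simp add: ennreal_mult_top)
  qed
  let ?G = "\<lambda>y. ennreal (gauss_density (A t *v x + B t *v u) (\<Sigma> t) y)"
  have "AE y in lborel. ?G y * ennreal (V k y) = ?G y * ?F y"
    using eqI finI by (intro eta_le_nn_integral_AE_eq[of _ _ _ \<eta>] eta_le_mult_left IH)
      (auto simp: IV_def IF_def)
  then have "AE y in lborel. ?F y = ennreal (V k y)"
  proof eventually_elim
    case (elim y)
    have "?G y \<noteq> 0" "?G y \<noteq> \<infinity>" using gauss_density_pos[OF Sigma_pd[OF t], of "A t *v x + B t *v u" y] by auto
    with elim show ?case by (simp add: ennreal_mult_cancel_left)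
  qed
  with pg show "(AE u in lborel. pol (T - Suc k) x u = g (T - Suc k) x u)
      \<and> (AE y in lborel. ?F y = ennreal (V k y))"
    by (simp add: t_def)
qed

lemma cost_to_go_bound:
  assumes adm: "admissible_policy T pol" and "k \<le> T"
  shows "eta_le \<eta> (ennreal (V k x)) (cost_to_go pol k x)"
  using \<open>k \<le> T\<close>
proof (induction k arbitrary: x)
  case 0
  show ?case by (simp add: V_0)
next
  case (Suc k)
  then show ?case by (intro cost_to_go_step(1)[OF adm]) auto
qed

text \<open>The initial law may be singular to Lebesgue measure, so at time 0 equality is known only
  almost everywhere for \<open>\<mu>0\<close>. A single initial state with equality gives it for
  Lebesgue-almost every state at time 1, and one such state at each later time carries it
  on.\<close>

lemma dynamic_programming_optimality:
  assumes T_pos: "T > 0" and mu0: "prob_space \<mu>0" "sets \<mu>0 = sets borel"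
    and adm: "admissible_policy T pol"
  shows "rs_objective T \<eta> A B \<Sigma> Q R \<mu>0 g \<le> rs_objective T \<eta> A B \<Sigma> Q R \<mu>0 pol"
    and "\<bar>rs_objective T \<eta> A B \<Sigma> Q R \<mu>0 g\<bar> \<noteq> \<infinity> \<Longrightarrow>
      rs_objective T \<eta> A B \<Sigma> Q R \<mu>0 pol \<le> rs_objective T \<eta> A B \<Sigma> Q R \<mu>0 g \<Longrightarrow>
      (AE x in \<mu>0. AE u in lborel. pol 0 x u = g 0 x u)
      \<and> (\<forall>t. 0 < t \<and> t < T \<longrightarrow> (AE x in lborel. AE u in lborel. pol t x u = g t x u))"
proof -
  have bound: "eta_le \<eta> (cost_to_go g T x) (cost_to_go pol T x)" for x
    using cost_to_go_bound[OF adm, of T x] by (simp add: cost_to_go_optimal)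
  then have le: "eta_le \<eta> (\<integral>\<^sup>+ x. cost_to_go g T x \<partial>\<mu>0) (\<integral>\<^sup>+ x. cost_to_go pol T x \<partial>\<mu>0)"
    by (rule eta_le_nn_integral)
  show opt: "rs_objective T \<eta> A B \<Sigma> Q R \<mu>0 g \<le> rs_objective T \<eta> A B \<Sigma> Q R \<mu>0 pol"
    unfolding rs_objective_def using eta le by (intro eta_log_mono)
  assume fin: "\<bar>rs_objective T \<eta> A B \<Sigma> Q R \<mu>0 g\<bar> \<noteq> \<infinity>"
    and "rs_objective T \<eta> A B \<Sigma> Q R \<mu>0 pol \<le> rs_objective T \<eta> A B \<Sigma> Q R \<mu>0 g"
  with opt have "rs_objective T \<eta> A B \<Sigma> Q R \<mu>0 g = rs_objective T \<eta> A B \<Sigma> Q R \<mu>0 pol" by simp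
  with fin have "(\<integral>\<^sup>+ x. cost_to_go g T x \<partial>\<mu>0) = (\<integral>\<^sup>+ x. cost_to_go pol T x \<partial>\<mu>0)
      \<and> (\<integral>\<^sup>+ x. cost_to_go g T x \<partial>\<mu>0) \<noteq> \<infinity>"
    unfolding rs_objective_def by (intro eta_log_inj[OF eta(2)])
  then have eq: "(\<integral>\<^sup>+ x. cost_to_go g T x \<partial>\<mu>0) = (\<integral>\<^sup>+ x. cost_to_go pol T x \<partial>\<mu>0)"
    and finI: "(\<integral>\<^sup>+ x. cost_to_go g T x \<partial>\<mu>0) \<noteq> \<infinity>"
    by blast+
  have "cost_to_go g T \<in> borel_measurable \<mu>0" "cost_to_go pol T \<in> borel_measurable \<mu>0"
    using borel_measurable_exp_cost_to_go[OF g_adm, of T \<eta> A B \<Sigma> Q R]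
      borel_measurable_exp_cost_to_go[OF adm, of T \<eta> A B \<Sigma> Q R] mu0(2)
    by (simp_all cong: measurable_cong_sets)
  then have "AE x in \<mu>0. cost_to_go g T x = cost_to_go pol T x"
    using bound eq finI by (rule eta_le_nn_integral_AE_eq)
  then have AE0: "AE x in \<mu>0. cost_to_go pol T x = ennreal (V T x)"
    by eventually_elim (simp add: cost_to_go_optimal)
  have step: "(AE u in lborel. pol t x u = g t x u)
      \<and> (AE y in lborel. cost_to_go pol (T - Suc t) y = ennreal (V (T - Suc t) y))"
    if "t < T" "cost_to_go pol (T - t) x = ennreal (V (T - t) x)" for t x
  proof -
    have "T - t = Suc (T - Suc t)" "T - Suc (T - Suc t) = t" "T - Suc t < T" using that(1) by auto
    with that(2) cost_to_go_step(2)[OF adm, of "T - Suc t" x] cost_to_go_bound[OF adm, of "T - Suc t"]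
    show ?thesis by auto
  qed
  have pol0: "AE x in \<mu>0. AE u in lborel. pol 0 x u = g 0 x u"
    using AE0 by eventually_elim (use step[of 0] T_pos in auto)
  obtain x0 where x0: "cost_to_go pol T x0 = ennreal (V T x0)"
  proof (rule ccontr)
    assume "\<not> thesis"
    with that have "AE x in \<mu>0. False" using AE0 by auto
    then show False using prob_space.AE_False[OF mu0(1)] by simp
  qed
  \<comment> \<open>The shift is deliberate: \<open>T - Suc t\<close> stages remain at time
    \<open>Suc t\<close>, the first time reached from \<open>t\<close> through a Gaussian
    transition.\<close>
  have AEt: "AE y in lborel. cost_to_go pol (T - Suc t) y = ennreal (V (T - Suc t) y)" if "Suc t \<le> T" for t
    using that
  proof (induction t)
    case 0
    then show ?case using step[of 0 x0] x0 T_pos by simp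
  next
    case (Suc t)
    then have "AE y in lborel. cost_to_go pol (T - Suc t) y = ennreal (V (T - Suc t) y)" by simp
    then obtain y where "cost_to_go pol (T - Suc t) y = ennreal (V (T - Suc t) y)"
      using AE_lborel_witness by blast
    then show ?case using step[of "Suc t" y] Suc.prems by simp
  qed
  have "AE x in lborel. AE u in lborel. pol t x u = g t x u" if "0 < t" "t < T" for t
  proof -
    obtain s where s: "t = Suc s" using \<open>0 < t\<close> by (cases t) auto
    have "AE x in lborel. cost_to_go pol (T - t) x = ennreal (V (T - t) x)"
      using AEt[of s] that by (simp add: s)
    then show ?thesis by eventually_elim (use step[of t] that in auto)
  qed
  with pol0 show "(AE x in \<mu>0. AE u in lborel. pol 0 x u = g 0 x u)
      \<and> (\<forall>t. 0 < t \<and> t < T \<longrightarrow> (AE x in lborel. AE u in lborel. pol t x u = g t x u))"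
    by blast
qed

end

text \<open>The finiteness premise for uniqueness matters when eta > 0 and \<open>\<mu>0\<close> has
  heavy tails: if the optimal value is infinite, every admissible policy attains it. For eta < 0 the
  optimal exponential cost is positive and bounded. \<open>ric_inv\<close> spells out that the
  inverse in the Riccati equation exists, since \<open>matrix_inv\<close> is total.\<close>

theorem theorem4:
  fixes T :: nat and \<eta> :: real
    and A :: "nat \<Rightarrow> real^'n^'n" and B :: "nat \<Rightarrow> real^'m^'n"
    and \<Sigma> Q :: "nat \<Rightarrow> real^'n^'n" and R :: "nat \<Rightarrow> real^'m^'m"
    and P :: "nat \<Rightarrow> real^'n^'n"
    and \<mu>0 :: "(real^'n) measure"
  assumes T_pos: "T > 0"
    and eta: "\<eta> > -1" "\<eta> \<noteq> 0"
    and Sigma_pd: "\<forall>t<T. pos_def (\<Sigma> t)"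
    and Q_pd: "\<forall>t\<le>T. pos_def (Q t)"
    and R_pd: "\<forall>t<T. pos_def (R t)"
    and mu0: "prob_space \<mu>0" "sets \<mu>0 = sets borel"
    and ric_inv: "\<forall>t<T. invertible (mat 1 - \<eta> *\<^sub>R (\<Sigma> t ** P (Suc t))
                           + B t ** matrix_inv (R t) ** transpose (B t) ** P (Suc t))"
    and ric: "\<forall>t<T. P t = Q t + transpose (A t) ** P (Suc t)
                 ** matrix_inv (mat 1 - \<eta> *\<^sub>R (\<Sigma> t ** P (Suc t))
                               + B t ** matrix_inv (R t) ** transpose (B t) ** P (Suc t))
                 ** A t"
    and ric_T: "P T = Q T"
    and cond: "\<forall>t<T. pos_def (matrix_inv (\<Sigma> t) - \<eta> *\<^sub>R P (Suc t))"
  shows "admissible_policy T (opt_policy \<eta> A B \<Sigma> R P)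
       \<and> (\<forall>pol. admissible_policy T pol \<longrightarrow>
            rs_objective T \<eta> A B \<Sigma> Q R \<mu>0 (opt_policy \<eta> A B \<Sigma> R P)
              \<le> rs_objective T \<eta> A B \<Sigma> Q R \<mu>0 pol)
       \<and> (\<bar>rs_objective T \<eta> A B \<Sigma> Q R \<mu>0 (opt_policy \<eta> A B \<Sigma> R P)\<bar> \<noteq> \<infinity> \<longrightarrow>
          (\<forall>pol. admissible_policy T pol \<longrightarrow>
            rs_objective T \<eta> A B \<Sigma> Q R \<mu>0 pol
              \<le> rs_objective T \<eta> A B \<Sigma> Q R \<mu>0 (opt_policy \<eta> A B \<Sigma> R P) \<longrightarrow>
            (AE x in \<mu>0. AE u in lborel. pol 0 x u = opt_policy \<eta> A B \<Sigma> R P 0 x u)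
            \<and> (\<forall>t. 0 < t \<and> t < T \<longrightarrow>
                 (AE x in lborel. AE u in lborel. pol t x u = opt_policy \<eta> A B \<Sigma> R P t x u))))"
proof -
  let ?g = "opt_policy \<eta> A B \<Sigma> R P"
  define W where "W = (\<lambda>t. P (Suc t) ** Mmat \<eta> \<Sigma> P t)"
  define K where "K = (\<lambda>t. R t + transpose (B t) ** W t ** B t)"
  have W: "W t = P (Suc t) ** matrix_inv (mat 1 - \<eta> *\<^sub>R (\<Sigma> t ** P (Suc t)))" for t
    by (simp add: W_def Mmat_def)
  have g_eq: "?g t x u = gauss_density
      (- (matrix_inv (K t) *v (transpose (B t) *v (W t *v (A t *v x))))) (matrix_inv (K t)) u" for t x u
    by (simp only: opt_policy_def Let_def K_def W_def matrix_vector_mul_assoc matrix_mul_assoc)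

  have K: "K t = R t + transpose (B t) ** W t ** B t" for t
    by (simp add: K_def)
  have S: "pos_def (\<Sigma> t)" and M: "pos_def (matrix_inv (\<Sigma> t) - \<eta> *\<^sub>R P (Suc t))"
    and Qt: "pos_def (Q t)" and Rt: "pos_def (R t)" if "t < T" for t
    using that Sigma_pd cond Q_pd R_pd by simp_all
  note G = ric_inv[rule_format] and Pt = ric[rule_format]
  \<comment> \<open>\<open>inc_induct\<close> runs downward from \<open>T\<close>, where positive
    definiteness comes from \<open>Q T\<close>.\<close>
  have P_pd: "pos_def (P t)" if "t \<le> T" for t
    using that
  proof (induction rule: inc_induct)
    case base
    show ?case using Q_pd by (simp add: ric_T)
  next
    case (step t)
    show ?case
      by (rule riccati_pos_def[OF eta(2) S step.IH M refl refl W Qt Rt K refl G Pt]) (fact step.hyps)+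
  qed
  have K_pd: "pos_def (K t)" if t: "t < T" for t
  proof -
    have "pos_def (P (Suc t))" using t by (intro P_pd) simp
    from control_precision_pos_def[OF eta(2) S this M refl refl W Qt Rt K refl G Pt, OF t t t t t t]
    show ?thesis .
  qed
  have S_pd: "pos_def (matrix_inv (K t))" if "t < T" for t
    using K_pd[OF that] by (rule pos_def_matrix_inv)

  have adm: "admissible_policy T ?g"
    unfolding admissible_policy_def
  proof (intro allI impI conjI)
    fix t assume t: "t < T"
    have "case_prod (?g t) = (\<lambda>z. gauss_density
      (- (matrix_inv (K t) *v (transpose (B t) *v (W t *v (A t *v fst z))))) (matrix_inv (K t)) (snd z))"
      by (auto simp: g_eq fun_eq_iff)
    also have "\<dots> \<in> borel_measurable (borel \<Otimes>\<^sub>M borel)" by measurable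
    finally show "case_prod (?g t) \<in> borel_measurable borel" by (simp add: borel_prod)
    show "0 \<le> ?g t x u" for x u
      unfolding g_eq using gauss_density_pos[OF S_pd[OF t]] by (simp add: less_imp_le)
    show "(\<integral>\<^sup>+ u. ennreal (?g t x u) \<partial>lborel) = 1" for x
      unfolding g_eq by (rule nn_integral_gauss_density[OF S_pd[OF t]])
  qed

  define \<Phi> where "\<Phi> = (\<lambda>t D c. \<forall>x u. ennreal (exp (\<eta> * stage_cost (Q t) (R t) x u))
      * (\<integral>\<^sup>+ y. ennreal (gauss_density (A t *v x + B t *v u) (\<Sigma> t) y)
            * ennreal (D * exp (\<eta> * (y \<bullet> (P (Suc t) *v y) / 2))) \<partial>lborel)
      = ennreal (c * exp (\<eta> * (x \<bullet> (P t *v x) / 2)) * ?g t x u powr (- \<eta>)))"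
  have ex_c: "\<exists>c>0. \<Phi> t D c" if t: "t < T" and D: "D > 0" for t D
  proof -
    have "pos_def (P (Suc t))" using t by (intro P_pd) simp
    from bellman_integrand[OF eta(2) S this M refl refl W Qt Rt K refl G Pt D, OF t t t t t t]
    show ?thesis unfolding \<Phi>_def g_eq .
  qed
  \<comment> \<open>Only the existence of the stage constant is known, for each time and each
    constant inherited from the later stages, so it is chosen.\<close>
  define c where "c = (\<lambda>t D. SOME c. c > 0 \<and> \<Phi> t D c)"
  have c: "c t D > 0 \<and> \<Phi> t D (c t D)" if "t < T" "D > 0" for t D
    unfolding c_def using ex_c[OF that] by (rule someI_ex)
  \<comment> \<open>\<open>D k\<close> accumulates the constants of the last \<open>k\<close>
    stages; stage \<open>k + 1\<close> from the end is played at time \<open>T - Suc k\<close>. The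
    start value 1 makes \<open>V 0\<close> the exponential of the terminal cost.\<close>
  define D where "D = rec_nat (1::real) (\<lambda>k d. c (T - Suc k) d)"
  have D_simps: "D 0 = 1" "D (Suc k) = c (T - Suc k) (D k)" for k by (simp_all add: D_def)
  have D_pos: "D k > 0" if "k \<le> T" for k
    using that by (induction k) (use c in \<open>auto simp: D_simps\<close>)
  define V where "V = (\<lambda>k x. D k * exp (\<eta> * (x \<bullet> (P (T - k) *v x) / 2)))"
  have bellman: "ennreal (exp (\<eta> * stage_cost (Q t) (R t) x u))
        * (\<integral>\<^sup>+ y. ennreal (gauss_density (A t *v x + B t *v u) (\<Sigma> t) y) * ennreal (V k y) \<partial>lborel)
      = ennreal (V (Suc k) x * ?g t x u powr (- \<eta>))"
    if "k < T" "t = T - Suc k" for k t x u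
  proof -
    have "t < T" "T - k = Suc t" "D k > 0" using that D_pos[of k] by auto
    then show ?thesis using c[of t "D k"] that(2) by (simp add: V_def D_simps \<Phi>_def)
  qed
  have V_pos: "0 < V k x" if "k \<le> T" for k x using D_pos[OF that] by (simp add: V_def)
  have V_0: "V 0 x = exp (\<eta> * term_cost (Q T) x)" for x
    by (simp add: V_def D_simps term_cost_def ric_T)
  have g_pos: "0 < ?g t x u" if "t < T" for t x u
    unfolding g_eq using gauss_density_pos[OF S_pd[OF that]] .
  have le: "rs_objective T \<eta> A B \<Sigma> Q R \<mu>0 ?g \<le> rs_objective T \<eta> A B \<Sigma> Q R \<mu>0 pol"
    if "admissible_policy T pol" for pol :: "nat \<Rightarrow> real^'n \<Rightarrow> real^'m \<Rightarrow> real"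
    by (rule dynamic_programming_optimality(1)[where V = V and A = A and B = B and Q = Q and R = R
        and \<Sigma> = \<Sigma> and \<eta> = \<eta>])
      (erule S | erule g_pos | erule V_pos | erule (1) bellman | rule eta adm V_0 T_pos mu0 that)+
  have uniq: "(AE x in \<mu>0. AE u in lborel. pol 0 x u = ?g 0 x u)
      \<and> (\<forall>t. 0 < t \<and> t < T \<longrightarrow> (AE x in lborel. AE u in lborel. pol t x u = ?g t x u))"
    if "admissible_policy T pol" "\<bar>rs_objective T \<eta> A B \<Sigma> Q R \<mu>0 ?g\<bar> \<noteq> \<infinity>"
      "rs_objective T \<eta> A B \<Sigma> Q R \<mu>0 pol \<le> rs_objective T \<eta> A B \<Sigma> Q R \<mu>0 ?g"
    for pol :: "nat \<Rightarrow> real^'n \<Rightarrow> real^'m \<Rightarrow> real"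
    by (rule dynamic_programming_optimality(2)[where V = V and A = A and B = B and Q = Q and R = R
        and \<Sigma> = \<Sigma> and \<eta> = \<eta>])
      (erule S | erule g_pos | erule V_pos | erule (1) bellman | rule eta adm V_0 T_pos mu0 that)+
  show ?thesis
    by (rule conjI[OF adm], rule conjI, rule allI, rule impI, erule le,
        rule impI, rule allI, rule impI, rule impI, rule uniq)
qed

end
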